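(* (i) $\mathbb Q=\mathbb M_\gamma(\mathtt{a^+tsa^+})$. (ii) $\mathbb A\wedge\overline{\mathbb A}=\mathbb A_0\vee\mathbb Q=\mathbb M_\gamma(\mathtt{a^+b^+},\mathtt{a^+tsa^+})$. (iii) $\mathbb A=\mathbb M_\gamma(\mathtt{a^+b^+ta^+})$ and, dually, $\overline{\mathbb A}=\mathbb M_\gamma(\mathtt{a^+tb^+a^+})$. (iv) $\mathbb A\vee\overline{\mathbb A}=\mathbb M_\gamma(\mathtt{a^+b^+ta^+},\mathtt{a^+tb^+a^+})$.
   Context: Monoids are regarded as semigroups with an additional nullary operation fixing the identity element; varieties are varieties of monoids, $\vee$ and $\wedge$ are join and intersection of varieties, and $\overline{\mathbb V}$ denotes the variety dual to $\mathbb V$, i.e. consisting of all monoids anti-isomorphic to monoids of $\mathbb V$. For a semigroup $S$, $S^1$ is the monoid obtained by adjoining an identity element. Let $A_0=\langle e,f\mid e^2=e,\ f^2=f,\ ef=0\rangle$, $Q=\langle e,b,c\mid e^2=e,\ eb=b,\ ce=c,\ ec=be=cb=0\rangle$, $A=\langle e,f,c\mid e^2=e,\ f^2=f,\ ef=ce=0,\ ec=cf=c\rangle=\{e,f,c,fe,fc,0\}$ (semigroups with zero $0$), and let $\mathbb A_0$, $\mathbb Q$, $\mathbb A$ be the monoid varieties generated by $A_0^1$, $Q^1$, $A^1$ respectively. Let $\mathfrak A$ be a countably infinite alphabet, $\mathfrak A^*$ the free monoid over it; $a,b,t,s$ are distinct letters. A letter is multiple in a word if it occurs in it at least twice; $\operatorname{mul}(\mathbf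 u)$ is the set of multiple letters of $\mathbf u$. Let $\tau_1$ be the congruence on $\mathfrak A^*$ generated by the relations $a=a^2$, $a\in\mathfrak A$. The congruence $\gamma$ is given by: $\mathbf u\,\gamma\,\mathbf v$ iff $\mathbf u\,\tau_1\,\mathbf v$ and $\operatorname{mul}(\mathbf u)=\operatorname{mul}(\mathbf v)$. In $\mathfrak A^*/\gamma$ write $\mathtt a=\{a\}$ and $\mathtt a^+=\{a^n\mid n\ge 2\}$ for each letter $a$; juxtaposition of such symbols denotes the product in $\mathfrak A^*/\gamma$. Thus $\mathtt{a^+b^+}=\{a^nb^m\mid n,m\ge2\}$, $\mathtt{a^+tsa^+}=\{a^ntsa^k\mid n,k\ge1\}$, $\mathtt{a^+b^+ta^+}=\{a^nb^mta^k\mid n,k\ge1,\ m\ge2\}$, $\mathtt{a^+tb^+a^+}=\{a^ntb^ma^k\mid n,k\ge1,\ m\ge2\}$. For a congruence $\tau$ on $\mathfrak A^*$ and $\tau$-classes $\mathtt u,\mathtt v$, write $\mathtt v\le_\tau\mathtt u$ if $\mathtt u=\mathtt p\,\mathtt v\,\mathtt s$ in $\mathfrak A^*/\tau$ for some $\mathtt p,\mathtt s\in\mathfrak A^*/\tau$. For a set $\mathtt W\subseteq\mathfrak A^*/\tau$ let $\mathtt W^{\le_\tau}=\{\mathtt v\mid \mathtt v\le_\tau\mathtt u \text{ for some }\mathtt u\in\mathtt W\}$, and let $M_\tau(\mathtt W)$ be the Rees quotient of $\mathfrak A^*/\tau$ over the ideal $(\mathfrak A^*/\tau)\setminus\mathtt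 W^{\le_\tau}$, i.e. the monoid $\mathtt W^{\le_\tau}\cup\{0\}$ in which the product of $\mathtt u,\mathtt v\in \mathtt W^{\le_\tau}$ is their product in $\mathfrak A^*/\tau$ if that lies in $\mathtt W^{\le_\tau}$, and all other products are $0$. $\mathbb M_\tau(\mathtt w_1,\dots,\mathtt w_k)$ denotes the monoid variety generated by $M_\tau(\{\mathtt w_1,\dots,\mathtt w_k\})$. *)

theory Defs
  imports "HOL-Algebra.Group"
begin

section \<open>Congruences and quotients\<close>

definition congruence_on :: "'a set \<Rightarrow> ('a \<Rightarrow> 'a \<Rightarrow> 'a) \<Rightarrow> ('a \<times> 'a) set \<Rightarrow> bool" where
  "congruence_on C m r \<longleftrightarrow>
     equiv C r \<and> (\<forall>x x' y y'. (x, x') \<in> r \<longrightarrow> (y, y') \<in> r \<longrightarrow> (m x y, m x' y') \<in> r)"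

definition generated_congruence ::
  "'a set \<Rightarrow> ('a \<Rightarrow> 'a \<Rightarrow> 'a) \<Rightarrow> ('a \<times> 'a) set \<Rightarrow> ('a \<times> 'a) set" where
  "generated_congruence C m R = \<Inter>{r. congruence_on C m r \<and> R \<subseteq> r}"

definition class_mult ::
  "('a \<Rightarrow> 'a \<Rightarrow> 'a) \<Rightarrow> ('a \<times> 'a) set \<Rightarrow> 'a set \<Rightarrow> 'a set \<Rightarrow> 'a set" where
  "class_mult m r X Y = (\<Union>x\<in>X. \<Union>y\<in>Y. r `` {m x y})"

section \<open>Varieties of monoids\<close>

type_synonym letter = nat
type_synonym word = "letter list"

definition eval :: "('a, 'm) monoid_scheme \<Rightarrow> (letter \<Rightarrow> 'a) \<Rightarrow> word \<Rightarrow> 'a" where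
  "eval G \<phi> w = foldr (\<lambda>x y. \<phi> x \<otimes>\<^bsub>G\<^esub> y) w \<one>\<^bsub>G\<^esub>"

definition satisfies :: "('a, 'm) monoid_scheme \<Rightarrow> word \<times> word \<Rightarrow> bool" where
  "satisfies G p \<longleftrightarrow>
     (\<forall>\<phi>. (\<forall>x. \<phi> x \<in> carrier G) \<longrightarrow> eval G \<phi> (fst p) = eval G \<phi> (snd p))"

text \<open>
  A variety is a class of monoids defined by a set of identities over a countably infinite
  alphabet. As HOL has no proper classes, a variety is represented by its members whose
  carrier lies in a type \<open>'x\<close>. When \<open>'x\<close> is infinite, this trace determines the variety
  (it contains a copy of the free object of countable rank), so equalities, inclusions, joins
  and intersections of varieties can be read off from the traces.
\<close>

definition models :: "(word \<times> word) set \<Rightarrow> 'x monoid set" where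
  "models \<Sigma> = {G. monoid G \<and> (\<forall>p\<in>\<Sigma>. satisfies G p)}"

definition is_variety :: "'x monoid set \<Rightarrow> bool" where
  "is_variety V \<longleftrightarrow> (\<exists>\<Sigma>. V = models \<Sigma>)"

text \<open>
  The least variety containing a monoid \<open>M\<close>. The carrier type of \<open>M\<close> need not be \<open>'x\<close>;
  \<open>M\<close> belongs to the variety defined by \<open>\<Sigma>\<close> iff it satisfies every identity in \<open>\<Sigma>\<close>.
\<close>

definition variety_generated_by :: "('a, 'm) monoid_scheme \<Rightarrow> 'x monoid set" where
  "variety_generated_by M = \<Inter>{models \<Sigma> |\<Sigma>. \<forall>p\<in>\<Sigma>. satisfies M p}"

definition variety_join :: "'x monoid set \<Rightarrow> 'x monoid set \<Rightarrow> 'x monoid set" where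
  "variety_join V W = \<Inter>{U. is_variety U \<and> V \<union> W \<subseteq> U}"

definition variety_meet :: "'x monoid set \<Rightarrow> 'x monoid set \<Rightarrow> 'x monoid set" where
  "variety_meet V W = V \<inter> W"

definition opposite :: "'x monoid \<Rightarrow> 'x monoid" where
  "opposite G = \<lparr>carrier = carrier G, mult = (\<lambda>x y. y \<otimes>\<^bsub>G\<^esub> x), one = \<one>\<^bsub>G\<^esub>\<rparr>"

definition dual_variety :: "'x monoid set \<Rightarrow> 'x monoid set" where
  "dual_variety V = {G. monoid G \<and> (\<exists>H\<in>V. G \<cong> opposite H)}"

section \<open>Presentations of semigroups with zero\<close>

text \<open>
  In the free semigroup with zero over a set of generators, \<open>Some w\<close> is the nonempty word
  \<open>w\<close> and \<open>None\<close> is the zero.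
\<close>

definition free_zero_semigroup :: "'g set \<Rightarrow> 'g list option set" where
  "free_zero_semigroup X = insert None (Some ` (lists X - {[]}))"

fun zero_append :: "'g list option \<Rightarrow> 'g list option \<Rightarrow> 'g list option" where
  "zero_append (Some u) (Some v) = Some (u @ v)"
| "zero_append _ _ = None"

definition presentation_congruence ::
  "'g set \<Rightarrow> ('g list option \<times> 'g list option) set \<Rightarrow>
     ('g list option \<times> 'g list option) set" where
  "presentation_congruence X R = generated_congruence (free_zero_semigroup X) zero_append R"

text \<open>The monoid \<open>S\<^sup>1\<close> for a semigroup \<open>S\<close>; \<open>None\<close> is the adjoined identity.\<close>

definition adjoin_one :: "'a set \<Rightarrow> ('a \<Rightarrow> 'a \<Rightarrow> 'a) \<Rightarrow> 'a option monoid" where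
  "adjoin_one S m =
     \<lparr>carrier = insert None (Some ` S),
      mult = (\<lambda>x y. case x of None \<Rightarrow> y
                | Some u \<Rightarrow> (case y of None \<Rightarrow> x | Some v \<Rightarrow> Some (m u v))),
      one = None\<rparr>"

definition presented_monoid ::
  "'g set \<Rightarrow> ('g list option \<times> 'g list option) set \<Rightarrow> 'g list option set option monoid" where
  "presented_monoid X R =
     (let \<rho> = presentation_congruence X R
      in adjoin_one (free_zero_semigroup X // \<rho>) (class_mult zero_append \<rho>))"

datatype generator = Gen_e | Gen_f | Gen_b | Gen_c

definition A0_one :: "generator list option set option monoid" where
  "A0_one = presented_monoid {Gen_e, Gen_f}
     {(Some [Gen_e, Gen_e], Some [Gen_e]),
      (Some [Gen_f, Gen_f], Some [Gen_f]),
      (Some [Gen_e, Gen_f], None)}"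

definition Q_one :: "generator list option set option monoid" where
  "Q_one = presented_monoid {Gen_e, Gen_b, Gen_c}
     {(Some [Gen_e, Gen_e], Some [Gen_e]),
      (Some [Gen_e, Gen_b], Some [Gen_b]),
      (Some [Gen_c, Gen_e], Some [Gen_c]),
      (Some [Gen_e, Gen_c], None),
      (Some [Gen_b, Gen_e], None),
      (Some [Gen_c, Gen_b], None)}"

definition A_one :: "generator list option set option monoid" where
  "A_one = presented_monoid {Gen_e, Gen_f, Gen_c}
     {(Some [Gen_e, Gen_e], Some [Gen_e]),
      (Some [Gen_f, Gen_f], Some [Gen_f]),
      (Some [Gen_e, Gen_f], None),
      (Some [Gen_c, Gen_e], None),
      (Some [Gen_e, Gen_c], Some [Gen_c]),
      (Some [Gen_c, Gen_f], Some [Gen_c])}"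

definition var_A0 :: "'x monoid set" where
  "var_A0 = variety_generated_by A0_one"

definition var_Q :: "'x monoid set" where
  "var_Q = variety_generated_by Q_one"

definition var_A :: "'x monoid set" where
  "var_A = variety_generated_by A_one"

section \<open>The congruence \<open>\<gamma>\<close> and the monoids \<open>M\<^sub>\<tau>(W)\<close>\<close>

definition mul :: "word \<Rightarrow> letter set" where
  "mul w = {a. count_list w a \<ge> 2}"

definition tau1 :: "(word \<times> word) set" where
  "tau1 = generated_congruence UNIV (@) {([a], [a, a]) |a. True}"

definition gamma :: "(word \<times> word) set" where
  "gamma = {(u, v). (u, v) \<in> tau1 \<and> mul u = mul v}"

definition class_le :: "(word \<times> word) set \<Rightarrow> word set \<Rightarrow> word set \<Rightarrow> bool" where
  "class_le \<tau> v u \<longleftrightarrow>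
     (\<exists>p \<in> UNIV // \<tau>. \<exists>s \<in> UNIV // \<tau>.
        u = class_mult (@) \<tau> (class_mult (@) \<tau> p v) s)"

definition down_closure :: "(word \<times> word) set \<Rightarrow> word set set \<Rightarrow> word set set" where
  "down_closure \<tau> W = {v \<in> UNIV // \<tau>. \<exists>u\<in>W. class_le \<tau> v u}"

text \<open>In the Rees quotient, \<open>None\<close> is the zero.\<close>

definition rees_embed :: "(word \<times> word) set \<Rightarrow> word set set \<Rightarrow> word set \<Rightarrow> word set option" where
  "rees_embed \<tau> W u = (if u \<in> down_closure \<tau> W then Some u else None)"

definition M_monoid :: "(word \<times> word) set \<Rightarrow> word set set \<Rightarrow> word set option monoid" where
  "M_monoid \<tau> W =
     \<lparr>carrier = insert None (Some ` down_closure \<tau> W),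
      mult = (\<lambda>x y. case (x, y) of
                 (Some u, Some v) \<Rightarrow> rees_embed \<tau> W (class_mult (@) \<tau> u v)
               | _ \<Rightarrow> None),
      one = rees_embed \<tau> W (\<tau> `` {[]})\<rparr>"

definition var_M :: "(word \<times> word) set \<Rightarrow> word set set \<Rightarrow> 'x monoid set" where
  "var_M \<tau> W = variety_generated_by (M_monoid \<tau> W)"

text \<open>The symbols from which the elements of \<open>\<AA>\<^sup>*/\<gamma>\<close> are written, and their product.\<close>

definition once :: "letter \<Rightarrow> word set" where
  "once a = {[a]}"

definition mplus :: "letter \<Rightarrow> word set" where
  "mplus a = {replicate n a |n. n \<ge> 2}"

definition gamma_mult :: "word set \<Rightarrow> word set \<Rightarrow> word set" (infixl \<open>\<cdot>\<^sub>\<gamma>\<close> 70) where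
  "X \<cdot>\<^sub>\<gamma> Y = class_mult (@) gamma X Y"

end

theory Submission
  imports Defs
begin

text \<open>Varieties appear only through their members in one type. A join, being a least variety,
  can be computed from identities as soon as some member of that type satisfies exactly the given
  identities; the actions on three states supply it, since finitely many relations fit into any
  infinite type.

  The identities of A are never characterised by subsequences. \<open>agree_A\<close> is a
  sufficient condition, while \<open>agree2\<close>, \<open>agree_Q\<close> and
  \<open>ids_A_sub3\<close> are necessary ones, and the gap between them shapes the meet: A_0 and Q
  give all pairs, but triples only when both outer letters are simple, whereas
  \<open>agree_A\<close> asks for all triples \<open>yzx\<close> with simple x. Saturation closes
  this gap by making the doubtful triples present on both sides. A saturated word is not reached by
  a rewriting process; it is chosen with the greatest number of triples among the words equivalent
  to the given one, so no termination order has to be found.\<close>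

text \<open>
  All equalities are read off from the identities of the monoids involved. \<open>A\<^sub>0\<^sup>1\<close>, \<open>A\<^sup>1\<close> and \<open>Q\<^sup>1\<close>
  are represented faithfully by relations on three states, so an identity holds iff both sides act
  equally under all substitutions by words in the generators. For \<open>M\<^sub>\<gamma>(W)\<close> it holds iff under every
  substitution both sides are \<open>\<gamma>\<close>-equivalent as soon as one of them is a factor of a word in \<open>W\<close>.
  Each of the generating semigroups embeds into its \<open>M\<^sub>\<gamma>\<close> (e.g. \<open>f, e, c\<close> become
  \<open>a\<^sup>+, b\<^sup>+, b\<^sup>+ta\<^sup>+\<close>), and conversely every factor of the defining word is determined up to \<open>\<gamma>\<close> by the
  identities of the semigroup.

  For the meet, let \<open>u \<approx> v\<close> hold in \<open>A\<^sub>0\<^sup>1\<close> and \<open>Q\<^sup>1\<close>. Call the segments between consecutive simple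
  letters blocks. Modulo the dual of \<open>\<AA>\<close>, a letter of a block that occurs again later
  may be inserted at the end of that block. After all such insertions, \<open>u\<close> and \<open>v\<close> agree on the
  subsequences \<open>yzx\<close> with \<open>x\<close> simple, which together with the subsequences of length two is enough
  for an identity of \<open>\<AA>\<close>.
\<close>

section \<open>Varieties and identities\<close>

lemma variety_generated_by_eq:
  "(variety_generated_by M :: 'x monoid set) = models {p. satisfies M p}"
proof
  show "variety_generated_by M \<subseteq> (models {p. satisfies M p} :: 'x monoid set)"
    unfolding variety_generated_by_def by (rule Inter_lower) auto
  show "(models {p. satisfies M p} :: 'x monoid set) \<subseteq> variety_generated_by M"
    unfolding variety_generated_by_def models_def by auto
qed

lemma models_antimono: "\<Sigma> \<subseteq> \<Sigma>' \<Longrightarrow> models \<Sigma>' \<subseteq> models \<Sigma>"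
  unfolding models_def by auto

text \<open>\<open>H\<^sub>1\<close> and \<open>H\<^sub>2\<close> turn an inclusion of classes into
  one of identities: if \<open>models \<Sigma>\<close> contains a monoid satisfying exactly
  \<open>E\<^sub>1\<close>, then \<Sigma> lies in \<open>E\<^sub>1\<close>.\<close>

lemma variety_join_models:
  fixes H\<^sub>1 H\<^sub>2 :: "'x monoid"
  assumes "monoid H\<^sub>1" "\<And>p. satisfies H\<^sub>1 p \<longleftrightarrow> p \<in> E\<^sub>1"
    and "monoid H\<^sub>2" "\<And>p. satisfies H\<^sub>2 p \<longleftrightarrow> p \<in> E\<^sub>2"
  shows "(variety_join (models E\<^sub>1) (models E\<^sub>2) :: 'x monoid set) = models (E\<^sub>1 \<inter> E\<^sub>2)"
proof
  show "(variety_join (models E\<^sub>1) (models E\<^sub>2) :: 'x monoid set) \<subseteq> models (E\<^sub>1 \<inter> E\<^sub>2)"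
    unfolding variety_join_def is_variety_def
    by (rule Inter_lower) (auto simp: models_def)
  show "models (E\<^sub>1 \<inter> E\<^sub>2) \<subseteq> (variety_join (models E\<^sub>1) (models E\<^sub>2) :: 'x monoid set)"
    unfolding variety_join_def
  proof (rule Inter_greatest)
    fix U :: "'x monoid set"
    assume "U \<in> {U. is_variety U \<and> models E\<^sub>1 \<union> models E\<^sub>2 \<subseteq> U}"
    then obtain \<Sigma> where U: "U = models \<Sigma>" and sub: "models E\<^sub>1 \<union> models E\<^sub>2 \<subseteq> U"
      unfolding is_variety_def by auto
    have "H\<^sub>1 \<in> models E\<^sub>1" "H\<^sub>2 \<in> models E\<^sub>2"
      using assms unfolding models_def by auto
    then have "H\<^sub>1 \<in> models \<Sigma>" "H\<^sub>2 \<in> models \<Sigma>"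
      using sub U by auto
    then have "\<Sigma> \<subseteq> E\<^sub>1 \<inter> E\<^sub>2"
      using assms(2,4) unfolding models_def by auto
    then show "models (E\<^sub>1 \<inter> E\<^sub>2) \<subseteq> U"
      unfolding U by (rule models_antimono)
  qed
qed

section \<open>Reversed identities, opposite monoids and dual varieties\<close>

definition rev_ids :: "(word \<times> word) set \<Rightarrow> (word \<times> word) set" where
  "rev_ids E = {(u, v). (rev u, rev v) \<in> E}"

lemma rev_ids_iff [simp]: "(u, v) \<in> rev_ids E \<longleftrightarrow> (rev u, rev v) \<in> E"
  by (simp add: rev_ids_def)

lemma eval_Nil [simp]: "eval G \<phi> [] = \<one>\<^bsub>G\<^esub>"
  and eval_Cons [simp]: "eval G \<phi> (x # w) = \<phi> x \<otimes>\<^bsub>G\<^esub> eval G \<phi> w"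
  by (simp_all add: eval_def)

lemma eval_closed:
  assumes "monoid G" "\<And>x. \<phi> x \<in> carrier G"
  shows "eval G \<phi> w \<in> carrier G"
  using assms by (induction w) (auto intro: monoid.m_closed monoid.one_closed)

lemma eval_append:
  assumes "monoid G" "\<And>x. \<phi> x \<in> carrier G"
  shows "eval G \<phi> (v @ w) = eval G \<phi> v \<otimes>\<^bsub>G\<^esub> eval G \<phi> w"
  using assms by (induction v) (simp_all add: monoid.m_assoc monoid.l_one eval_closed)

lemma monoid_opposite:
  assumes "monoid G"
  shows "monoid (opposite G)"
  using assms
  by unfold_locales (auto simp: opposite_def monoid.m_assoc monoid.m_closed monoid.l_one monoid.r_one)

lemma opposite_opposite [simp]: "opposite (opposite G) = G"
  by (simp add: opposite_def)

lemma eval_opposite: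
  assumes "monoid G" "\<And>x. \<phi> x \<in> carrier G"
  shows "eval (opposite G) \<phi> w = eval G \<phi> (rev w)"
proof (induction w)
  case (Cons x w)
  have "eval (opposite G) \<phi> (x # w) = eval G \<phi> (rev w) \<otimes>\<^bsub>G\<^esub> \<phi> x"
    using Cons by (simp add: opposite_def)
  also have "\<dots> = eval G \<phi> (rev w @ [x])"
    using assms by (simp add: eval_append monoid.r_one)
  finally show ?case by simp
qed (simp add: opposite_def)

lemma satisfies_opposite:
  assumes "monoid G"
  shows "satisfies (opposite G) (u, v) \<longleftrightarrow> satisfies G (rev u, rev v)"
proof -
  have "carrier (opposite G) = carrier G"
    by (simp add: opposite_def)
  then show ?thesis
    unfolding satisfies_def using eval_opposite[OF assms] by fastforce
qed

lemma satisfies_iso: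
  assumes "monoid G" "monoid H" "G \<cong> H" "satisfies H p"
  shows "satisfies G p"
proof -
  obtain h where h: "h \<in> iso G H"
    using assms(3) by (auto simp: is_iso_def)
  then have hom: "h \<in> hom G H" and inj: "inj_on h (carrier G)" and im: "h ` carrier G = carrier H"
    by (auto simp: iso_def bij_betw_def)
  have mult: "h (x \<otimes>\<^bsub>G\<^esub> y) = h x \<otimes>\<^bsub>H\<^esub> h y" if "x \<in> carrier G" "y \<in> carrier G" for x y
    using hom that by (simp add: hom_def)
  \<comment> \<open>A \<open>hom\<close> preserves only the multiplication; that the unit goes to
    the unit comes from surjectivity.\<close>
  have one: "h \<one>\<^bsub>G\<^esub> = \<one>\<^bsub>H\<^esub>"
  proof -
    obtain z where z: "z \<in> carrier G" "h z = \<one>\<^bsub>H\<^esub>"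
      using im assms(2) by (metis imageE monoid.one_closed)
    have "h \<one>\<^bsub>G\<^esub> = h \<one>\<^bsub>G\<^esub> \<otimes>\<^bsub>H\<^esub> h z"
      using z im assms by (metis image_eqI monoid.one_closed monoid.r_one)
    also have "\<dots> = h (\<one>\<^bsub>G\<^esub> \<otimes>\<^bsub>G\<^esub> z)"
      using z mult assms(1) by (metis monoid.one_closed)
    also have "\<dots> = \<one>\<^bsub>H\<^esub>"
      using z assms(1) by (simp add: monoid.l_one)
    finally show ?thesis .
  qed
  show ?thesis
    unfolding satisfies_def
  proof (intro allI impI)
    fix \<phi> :: "letter \<Rightarrow> _"
    assume \<phi>: "\<forall>x. \<phi> x \<in> carrier G"
    have eval_h: "eval H (h \<circ> \<phi>) w = h (eval G \<phi> w)" for w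
      using \<phi> assms(1) by (induction w) (simp_all add: one mult eval_closed)
    have "\<forall>x. (h \<circ> \<phi>) x \<in> carrier H"
      using \<phi> im by auto
    then have "h (eval G \<phi> (fst p)) = h (eval G \<phi> (snd p))"
      using assms(4) unfolding satisfies_def eval_h[symmetric] by blast
    then show "eval G \<phi> (fst p) = eval G \<phi> (snd p)"
      using inj \<phi> assms(1) by (auto dest: inj_onD simp: eval_closed)
  qed
qed

lemma dual_variety_models: "(dual_variety (models E) :: 'x monoid set) = models (rev_ids E)"
proof (intro equalityI subsetI)
  fix G :: "'x monoid"
  assume "G \<in> dual_variety (models E)"
  then obtain H :: "'x monoid" where G: "monoid G" "G \<cong> opposite H" and H: "monoid H" "\<forall>p\<in>E. satisfies H p"
    unfolding dual_variety_def models_def by blast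
  have "satisfies G p" if "p \<in> rev_ids E" for p
  proof (rule satisfies_iso[OF G(1) monoid_opposite[OF H(1)] G(2)])
    show "satisfies (opposite H) p"
      using that H satisfies_opposite by (cases p) auto
  qed
  then show "G \<in> models (rev_ids E)"
    using G unfolding models_def by auto
next
  fix G :: "'x monoid"
  assume "G \<in> models (rev_ids E)"
  then have G: "monoid G" "\<forall>p\<in>rev_ids E. satisfies G p"
    unfolding models_def by auto
  have "satisfies (opposite G) (u, v)" if "(u, v) \<in> E" for u v
    using that G by (auto simp: satisfies_opposite)
  then have "opposite G \<in> models E"
    using G monoid_opposite unfolding models_def by auto
  moreover have "G \<cong> opposite (opposite G)"
    by (simp add: iso_refl)
  ultimately show "G \<in> dual_variety (models E)"
    using G unfolding dual_variety_def by blast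
qed

section \<open>Substitutions of words for letters\<close>

abbreviation subst :: "(letter \<Rightarrow> 'a list) \<Rightarrow> word \<Rightarrow> 'a list" where
  "subst \<theta> w \<equiv> concat (map \<theta> w)"

lemma subst_subst: "subst \<theta> (subst \<eta> w) = subst (\<lambda>x. subst \<theta> (\<eta> x)) w"
  by (induction w) simp_all

lemma subst_in_lists: "(\<And>x. \<theta> x \<in> lists X) \<Longrightarrow> subst \<theta> w \<in> lists X"
  by (induction w) auto

lemma rev_subst: "rev (subst \<theta> w) = subst (\<lambda>x. rev (\<theta> x)) (rev w)"
  by (induction w) simp_all

section \<open>Representations by relations\<close>

datatype state = S0 | S1 | S2

lemma UNIV_state: "UNIV = {S0, S1, S2}"
  by (auto intro: state.exhaust)

instance state :: finite
  by standard (simp add: UNIV_state)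

definition act :: "('a \<Rightarrow> state rel) \<Rightarrow> 'a list \<Rightarrow> state rel" where
  "act \<tau> w = foldr (\<lambda>g r. \<tau> g O r) w Id"

lemma act_Nil [simp]: "act \<tau> [] = Id"
  and act_Cons [simp]: "act \<tau> (g # w) = \<tau> g O act \<tau> w"
  by (simp_all add: act_def)

lemma act_append [simp]: "act \<tau> (v @ w) = act \<tau> v O act \<tau> w"
  by (induction v) (simp_all add: O_assoc)

lemma act_subst: "act \<tau> (subst \<theta> w) = act (\<lambda>x. act \<tau> (\<theta> x)) w"
  by (induction w) simp_all

text \<open>Substituted words may be empty: the empty word acts as \<open>Id\<close> and stands for
  the adjoined identity of S^1.\<close>

definition ids :: "('g \<Rightarrow> state rel) \<Rightarrow> 'g set \<Rightarrow> (word \<times> word) set" where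
  "ids \<tau> X = {(u, v). \<forall>\<theta>. (\<forall>x. \<theta> x \<in> lists X) \<longrightarrow> act \<tau> (subst \<theta> u) = act \<tau> (subst \<theta> v)}"

lemma idsD:
  "(u, v) \<in> ids \<tau> X \<Longrightarrow> (\<And>x. \<theta> x \<in> lists X) \<Longrightarrow> act \<tau> (subst \<theta> u) = act \<tau> (subst \<theta> v)"
  by (auto simp: ids_def)

lemma ids_subst:
  assumes "(u, v) \<in> ids \<tau> X"
  shows "(subst \<eta> u, subst \<eta> v) \<in> ids \<tau> X"
  using assms unfolding ids_def by (simp add: subst_subst subst_in_lists)

lemma ids_sym: "(u, v) \<in> ids \<tau> X \<Longrightarrow> (v, u) \<in> ids \<tau> X"
  by (simp add: ids_def)

text \<open>The witness is a copy of the finite monoid of all \<open>act \<tau> w\<close> inside the infinite type.\<close>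

lemma ids_realized:
  assumes "infinite (UNIV :: 'x set)"
  obtains H :: "'x monoid" where "monoid H" "\<And>p. satisfies H p \<longleftrightarrow> p \<in> ids \<tau> X"
proof -
  obtain f :: "state rel \<Rightarrow> 'x" where f: "inj f"
  proof -
    obtain B :: "'x set" where "finite B" "card B = card (UNIV :: state rel set)"
      using infinite_arbitrarily_large[OF assms] by blast
    then obtain f :: "state rel \<Rightarrow> 'x" where "bij_betw f UNIV B"
      using finite_same_card_bij[of UNIV B] finite_UNIV by metis
    then show ?thesis
      using that by (auto simp: bij_betw_def)
  qed
  define H :: "'x monoid" where
    "H = \<lparr>carrier = f ` act \<tau> ` lists X, mult = (\<lambda>x y. f (the_inv f x O the_inv f y)), one = f Id\<rparr>"
  have closed: "act \<tau> v O act \<tau> w \<in> act \<tau> ` lists X" if "v \<in> lists X" "w \<in> lists X" for v w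
    using that act_append[of \<tau> v w] by (metis append_in_lists_conv image_eqI)
  have one: "Id \<in> act \<tau> ` lists X"
    by (rule image_eqI[of _ _ "[]"]) simp_all
  have H: "monoid H"
    by unfold_locales (auto simp: H_def the_inv_f_f[OF f] O_assoc intro: closed one)
  have eval: "eval H (\<lambda>x. f (act \<tau> (\<theta> x))) w = f (act \<tau> (subst \<theta> w))" for \<theta> w
    by (induction w) (simp_all add: H_def the_inv_f_f[OF f])
  have "satisfies H (u, v) \<longleftrightarrow> (u, v) \<in> ids \<tau> X" for u v
  proof
    assume sat: "satisfies H (u, v)"
    show "(u, v) \<in> ids \<tau> X"
      unfolding ids_def
    proof clarify
      fix \<theta> :: "letter \<Rightarrow> _" assume "\<forall>x. \<theta> x \<in> lists X"
      then have "\<forall>x. f (act \<tau> (\<theta> x)) \<in> carrier H"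
        by (auto simp: H_def)
      from sat[unfolded satisfies_def, rule_format, OF this[rule_format]]
      show "act \<tau> (subst \<theta> u) = act \<tau> (subst \<theta> v)"
        by (simp add: eval inj_eq[OF f])
    qed
  next
    assume uv: "(u, v) \<in> ids \<tau> X"
    show "satisfies H (u, v)"
      unfolding satisfies_def
    proof (intro allI impI)
      fix \<phi> :: "letter \<Rightarrow> 'x"
      assume "\<forall>x. \<phi> x \<in> carrier H"
      then have "\<forall>x. \<exists>w. w \<in> lists X \<and> \<phi> x = f (act \<tau> w)"
        by (auto simp: H_def)
      then obtain \<theta> where \<theta>: "\<And>x. \<theta> x \<in> lists X" "\<And>x. \<phi> x = f (act \<tau> (\<theta> x))"
        by metis
      have "\<phi> = (\<lambda>x. f (act \<tau> (\<theta> x)))"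
        using \<theta> by auto
      then show "eval H \<phi> (fst (u, v)) = eval H \<phi> (snd (u, v))"
        using idsD[OF uv, of \<theta>] \<theta>(1) by (simp add: eval)
    qed
  qed
  then show ?thesis
    using that[OF H] by auto
qed

section \<open>Presented monoids\<close>

lemma congruence_generated:
  assumes R: "R \<subseteq> C \<times> C" and closed: "\<And>x y. x \<in> C \<Longrightarrow> y \<in> C \<Longrightarrow> m x y \<in> C"
  shows "congruence_on C m (generated_congruence C m R)"
proof -
  \<comment> \<open>The full relation is a member of the intersected family; the intersection of an
    empty family would be all of \<open>UNIV\<close>.\<close>
  have full: "congruence_on C m (C \<times> C)"
    unfolding congruence_on_def equiv_def refl_on_def sym_def trans_def by (simp add: closed)
  let ?r = "generated_congruence C m R"
  have I: "(x, y) \<in> ?r" if "\<And>r. congruence_on C m r \<Longrightarrow> R \<subseteq> r \<Longrightarrow> (x, y) \<in> r" for x y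
    using that unfolding generated_congruence_def by simp
  have D: "(x, y) \<in> r" if "(x, y) \<in> ?r" "congruence_on C m r" "R \<subseteq> r" for x y r
    using that unfolding generated_congruence_def by simp
  have E: "equiv C r" if "congruence_on C m r" for r
    using that by (simp add: congruence_on_def)
  have "?r \<subseteq> C \<times> C"
    using D[OF _ full R] by auto
  moreover have "refl_on C ?r"
    by (intro refl_onI I) (auto dest: E simp: equiv_def refl_on_def)
  moreover have "sym ?r"
    by (intro symI I) (meson D E equivE symE)
  moreover have "trans ?r"
    by (intro transI I) (meson D E equivE transE)
  moreover have "(m x y, m x' y') \<in> ?r" if "(x, x') \<in> ?r" "(y, y') \<in> ?r" for x x' y y'
  proof (rule I)
    fix r assume r: "congruence_on C m r" "R \<subseteq> r"
    then show "(m x y, m x' y') \<in> r"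
      using D[OF that(1) r] D[OF that(2) r] unfolding congruence_on_def by blast
  qed
  ultimately show ?thesis
    by (simp add: congruence_on_def equiv_def)
qed

lemma generated_congruence_least:
  "congruence_on C m r \<Longrightarrow> R \<subseteq> r \<Longrightarrow> generated_congruence C m R \<subseteq> r"
  unfolding generated_congruence_def by blast

lemma generators_in_congruence: "R \<subseteq> generated_congruence C m R"
  unfolding generated_congruence_def by blast

lemma zero_append_None [simp]: "zero_append p None = None" "zero_append None p = None"
  by (cases p; simp)+

lemma zero_append_closed:
  "p \<in> free_zero_semigroup X \<Longrightarrow> q \<in> free_zero_semigroup X \<Longrightarrow>
    zero_append p q \<in> free_zero_semigroup X"
  by (cases p; cases q) (auto simp: free_zero_semigroup_def image_iff)

lemma Some_in_free_zero_semigroup: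
  "Some w \<in> free_zero_semigroup X \<longleftrightarrow> w \<in> lists X \<and> w \<noteq> []"
  by (auto simp: free_zero_semigroup_def)

text \<open>
  A presentation whose monoid is represented faithfully by relations on the states; \<open>NF\<close> is a
  set of representatives of the nonidentity elements and \<open>z\<close> is a word for the zero.
\<close>

locale presentation =
  fixes \<tau> :: "'g \<Rightarrow> state rel" and X :: "'g set" and R :: "('g list option \<times> 'g list option) set"
    and NF :: "'g list option set" and z :: "'g list"
  assumes R: "R \<subseteq> free_zero_semigroup X \<times> free_zero_semigroup X"
    and R_act: "\<And>p q. (p, q) \<in> R \<Longrightarrow> case_option {} (act \<tau>) p = case_option {} (act \<tau>) q"
    and NF: "NF \<subseteq> free_zero_semigroup X" "None \<in> NF" "inj_on (case_option {} (act \<tau>)) NF"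
    and Id_NF: "Id \<notin> case_option {} (act \<tau>) ` NF"
    and start: "\<And>g. g \<in> X \<Longrightarrow> \<exists>n\<in>NF. (Some [g], n) \<in> presentation_congruence X R"
    and step: "\<And>g w. g \<in> X \<Longrightarrow> Some w \<in> NF \<Longrightarrow>
      \<exists>n\<in>NF. (Some (g # w), n) \<in> presentation_congruence X R"
    and z: "z \<in> lists X" "z \<noteq> []" "act \<tau> z = {}"
begin

abbreviation \<rho> where "\<rho> \<equiv> presentation_congruence X R"
abbreviation val where "val \<equiv> case_option {} (act \<tau>)"

lemma congruence: "congruence_on (free_zero_semigroup X) zero_append \<rho>"
  unfolding presentation_congruence_def
  by (rule congruence_generated[OF R]) (rule zero_append_closed)

lemma equiv: "equiv (free_zero_semigroup X) \<rho>"
  using congruence by (simp add: congruence_on_def)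

lemma refl: "p \<in> free_zero_semigroup X \<Longrightarrow> (p, p) \<in> \<rho>"
  and sym: "(p, q) \<in> \<rho> \<Longrightarrow> (q, p) \<in> \<rho>"
  and trans: "(p, q) \<in> \<rho> \<Longrightarrow> (q, r) \<in> \<rho> \<Longrightarrow> (p, r) \<in> \<rho>"
  using equiv by (auto simp: equiv_def refl_on_def elim: symE transE)

text \<open>With the zero sent to the empty relation, \<open>val\<close> is multiplicative, so its
  kernel is a congruence containing the defining relations.\<close>

lemma val_eq: "(p, q) \<in> \<rho> \<Longrightarrow> val p = val q"
proof -
  have val_append: "val (zero_append p q) = val p O val q" for p q
    by (cases p; cases q) simp_all
  let ?K = "{(p, q). p \<in> free_zero_semigroup X \<and> q \<in> free_zero_semigroup X \<and> val p = val q}"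
  have "congruence_on (free_zero_semigroup X) zero_append ?K"
    unfolding congruence_on_def equiv_def refl_on_def sym_def trans_def
    by (simp add: val_append zero_append_closed) blast
  moreover have "R \<subseteq> ?K"
    using R R_act by auto
  ultimately have "\<rho> \<subseteq> ?K"
    unfolding presentation_congruence_def by (rule generated_congruence_least)
  then show "(p, q) \<in> \<rho> \<Longrightarrow> val p = val q" by auto
qed

text \<open>Representatives are closed under prepending a generator, by \<open>step\<close>, so a
  word is normalised from its right end.\<close>

lemma normal_form:
  assumes "w \<in> lists X" "w \<noteq> []"
  shows "\<exists>n\<in>NF. (Some w, n) \<in> \<rho>"
  using assms
proof (induction w rule: list.induct)
  case (Cons g w)
  show ?case
  proof (cases "w = []")
    case True
    then show ?thesis using Cons start by auto
  next
    case False
    then obtain n where n: "n \<in> NF" "(Some w, n) \<in> \<rho>"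
      using Cons by auto
    have "g \<in> X"
      using Cons.prems(1) by simp
    then have "(Some [g], Some [g]) \<in> \<rho>"
      by (intro refl) (simp add: Some_in_free_zero_semigroup)
    then have "(zero_append (Some [g]) (Some w), zero_append (Some [g]) n) \<in> \<rho>"
      using congruence n(2) unfolding congruence_on_def by blast
    then have eq: "(Some (g # w), zero_append (Some [g]) n) \<in> \<rho>"
      by simp
    show ?thesis
    proof (cases n)
      case None
      then show ?thesis using eq NF by auto
    next
      case (Some v)
      then obtain n' where "n' \<in> NF" "(Some (g # v), n') \<in> \<rho>"
        using step[of g v] n \<open>g \<in> X\<close> by blast
      moreover have "(Some (g # w), Some (g # v)) \<in> \<rho>"
        using eq Some by simp
      ultimately show ?thesis
        using trans by blast
    qed
  qed
qed simp

lemma act_in_NF: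
  assumes "w \<in> lists X" "w \<noteq> []"
  shows "act \<tau> w \<in> val ` NF"
proof -
  obtain n where "n \<in> NF" "(Some w, n) \<in> \<rho>"
    using normal_form[OF assms] by blast
  then show ?thesis
    using val_eq[of "Some w" n] by simp
qed

text \<open>This keeps the adjoined identity apart from the elements of the semigroup
  itself.\<close>

lemma act_eq_Id_iff: "w \<in> lists X \<Longrightarrow> act \<tau> w = Id \<longleftrightarrow> w = []"
  using act_in_NF[of w] Id_NF by (cases "w = []") auto

text \<open>Both elements are congruent to representatives, on which the representation is
  injective. The presented semigroup is therefore the semigroup of relations.\<close>

lemma congruence_iff:
  assumes "p \<in> free_zero_semigroup X" "q \<in> free_zero_semigroup X"
  shows "(p, q) \<in> \<rho> \<longleftrightarrow> val p = val q"
proof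
  have *: "\<exists>n\<in>NF. (p, n) \<in> \<rho>" if "p \<in> free_zero_semigroup X" for p
  proof (cases p)
    case None
    then show ?thesis
      using NF(2) that refl by blast
  next
    case (Some w)
    then show ?thesis
      using that normal_form by (simp add: Some_in_free_zero_semigroup)
  qed
  assume "val p = val q"
  moreover obtain n n' where n: "n \<in> NF" "(p, n) \<in> \<rho>" "n' \<in> NF" "(q, n') \<in> \<rho>"
    using * assms by blast
  ultimately have "val n = val n'"
    using val_eq by metis
  then have "n = n'"
    using n NF(3) by (auto dest: inj_onD)
  then show "(p, q) \<in> \<rho>"
    using n sym trans by blast
qed (rule val_eq)

lemma satisfies_iff: "satisfies (presented_monoid X R) (u, v) \<longleftrightarrow> (u, v) \<in> ids \<tau> X"
proof -
  \<comment> \<open>The element of S^1 named by a word; the empty word names the adjoined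
    identity.\<close>
  define K where "K w = (if w = [] then None else Some (\<rho> `` {Some w}))" for w
  have K_eq: "K p = K q \<longleftrightarrow> act \<tau> p = act \<tau> q" if "p \<in> lists X" "q \<in> lists X" for p q
    using that act_eq_Id_iff[of p] act_eq_Id_iff[of q]
      eq_equiv_class_iff[OF equiv, of "Some p" "Some q"]
      congruence_iff[of "Some p" "Some q"]
    by (auto simp: K_def Some_in_free_zero_semigroup)
  have class_mult: "class_mult zero_append \<rho> (\<rho> `` {Some p}) (\<rho> `` {Some q}) = \<rho> `` {Some (p @ q)}"
    if "p \<in> lists X" "p \<noteq> []" "q \<in> lists X" "q \<noteq> []" for p q
  proof -
    have "\<rho> `` {zero_append x y} = \<rho> `` {Some (p @ q)}"
      if "x \<in> \<rho> `` {Some p}" "y \<in> \<rho> `` {Some q}" for x y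
    proof -
      have "(zero_append (Some p) (Some q), zero_append x y) \<in> \<rho>"
        using that congruence unfolding congruence_on_def by blast
      then show ?thesis
        using equiv_class_eq[OF equiv] by fastforce
    qed
    moreover have "Some p \<in> \<rho> `` {Some p}" "Some q \<in> \<rho> `` {Some q}"
      using that equiv_class_self[OF equiv] by (simp_all add: Some_in_free_zero_semigroup)
    ultimately show ?thesis
      unfolding class_mult_def by blast
  qed
  have K_in: "K w \<in> carrier (presented_monoid X R)" if "w \<in> lists X" for w
  proof (cases "w = []")
    case False
    then have "Some w \<in> free_zero_semigroup X"
      using that by (simp add: Some_in_free_zero_semigroup)
    then show ?thesis
      using False by (simp add: K_def presented_monoid_def adjoin_one_def Let_def quotientI)
  qed (simp add: K_def presented_monoid_def adjoin_one_def Let_def)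
  have eval: "eval (presented_monoid X R) (\<lambda>x. K (\<theta> x)) w = K (subst \<theta> w)"
    if "\<And>x. \<theta> x \<in> lists X" for \<theta> w
  proof (induction w)
    case Nil
    then show ?case by (simp add: K_def presented_monoid_def adjoin_one_def Let_def)
  next
    case (Cons x w)
    have "subst \<theta> w \<in> lists X"
      using that by (rule subst_in_lists)
    moreover have "K p \<otimes>\<^bsub>presented_monoid X R\<^esub> K q = K (p @ q)"
      if "p \<in> lists X" "q \<in> lists X" for p q
      using that class_mult[of p q]
      by (cases "p = []"; cases "q = []")
        (simp_all add: K_def presented_monoid_def adjoin_one_def Let_def)
    ultimately show ?case
      using that[of x] Cons by simp
  qed
  have rep: "\<exists>w\<in>lists X. c = K w" if c: "c \<in> carrier (presented_monoid X R)" for c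
  proof (cases c)
    case None
    then show ?thesis by (intro bexI[of _ "[]"]) (simp_all add: K_def)
  next
    case (Some d)
    then obtain p where p: "p \<in> free_zero_semigroup X" "d = \<rho> `` {p}"
      using c by (auto simp: presented_monoid_def adjoin_one_def Let_def elim: quotientE)
    show ?thesis
    proof (cases p)
      case None
      \<comment> \<open>Substitutions take words as values, so the zero class has to contain a word:
        \<open>z\<close> acts as the empty relation.\<close>
      have "(None, Some z) \<in> \<rho>"
        using z congruence_iff by (simp add: free_zero_semigroup_def)
      then have "d = \<rho> `` {Some z}"
        using p None equiv_class_eq[OF equiv] by simp
      then show ?thesis
        using Some z by (intro bexI[of _ z]) (simp_all add: K_def)
    next
      case (Some w)
      then show ?thesis
        using \<open>c = Some d\<close> p
        by (intro bexI[of _ w]) (auto simp: K_def Some_in_free_zero_semigroup)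
    qed
  qed
  show ?thesis
  proof
    assume sat: "satisfies (presented_monoid X R) (u, v)"
    show "(u, v) \<in> ids \<tau> X"
      unfolding ids_def
    proof clarify
      fix \<theta> :: "letter \<Rightarrow> _" assume \<theta>: "\<forall>x. \<theta> x \<in> lists X"
      then have "\<forall>x. K (\<theta> x) \<in> carrier (presented_monoid X R)"
        using K_in by auto
      from sat[unfolded satisfies_def, rule_format, OF this[rule_format]]
      show "act \<tau> (subst \<theta> u) = act \<tau> (subst \<theta> v)"
        using \<theta> by (simp add: eval K_eq subst_in_lists)
    qed
  next
    assume uv: "(u, v) \<in> ids \<tau> X"
    show "satisfies (presented_monoid X R) (u, v)"
      unfolding satisfies_def
    proof (intro allI impI)
      fix \<phi> :: "letter \<Rightarrow> _"
      assume "\<forall>x. \<phi> x \<in> carrier (presented_monoid X R)"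
      then have "\<forall>x. \<exists>w\<in>lists X. \<phi> x = K w"
        using rep by blast
      then obtain \<theta> where \<theta>: "\<And>x. \<theta> x \<in> lists X" "\<And>x. \<phi> x = K (\<theta> x)"
        by metis
      have "\<phi> = (\<lambda>x. K (\<theta> x))"
        using \<theta> by auto
      then show "eval (presented_monoid X R) \<phi> (fst (u, v)) = eval (presented_monoid X R) \<phi> (snd (u, v))"
        using idsD[OF uv, of \<theta>] \<theta>(1) by (simp add: eval K_eq subst_in_lists)
    qed
  qed
qed

end

text \<open>Compatibility of the congruence speaks of nonempty words only, hence the case
  distinctions on empty contexts.\<close>

lemma presentation_congruence_context:
  assumes R: "R \<subseteq> free_zero_semigroup X \<times> free_zero_semigroup X"
    and "(Some l, r) \<in> presentation_congruence X R" "p \<in> lists X" "s \<in> lists X"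
  shows "(Some (p @ l @ s), case_option None (\<lambda>r. Some (p @ r @ s)) r) \<in> presentation_congruence X R"
proof -
  let ?\<rho> = "presentation_congruence X R"
  have cong: "congruence_on (free_zero_semigroup X) zero_append ?\<rho>"
    unfolding presentation_congruence_def
    by (rule congruence_generated[OF R]) (rule zero_append_closed)
  have refl: "(Some w, Some w) \<in> ?\<rho>" if "w \<in> lists X" "w \<noteq> []" for w
    using cong that unfolding congruence_on_def equiv_def refl_on_def
    by (simp add: Some_in_free_zero_semigroup)
  have app: "(zero_append x y, zero_append x' y') \<in> ?\<rho>" if "(x, x') \<in> ?\<rho>" "(y, y') \<in> ?\<rho>" for x y x' y'
    using cong that unfolding congruence_on_def by blast
  have left: "(Some (l @ s), case_option None (\<lambda>r. Some (r @ s)) r) \<in> ?\<rho>"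
    using assms(2) app[OF assms(2) refl[OF assms(4)]] by (cases "s = []"; cases r) simp_all
  show ?thesis
    using left app[OF refl[OF assms(3)] left] by (cases "p = []"; cases r) simp_all
qed

lemma presentation_congruence_rewrite:
  assumes "R \<subseteq> free_zero_semigroup X \<times> free_zero_semigroup X"
    and "(Some l, Some r) \<in> R" "p \<in> lists X" "s \<in> lists X"
    and "(Some (p @ r @ s), n) \<in> presentation_congruence X R"
  shows "(Some (p @ l @ s), n) \<in> presentation_congruence X R"
proof -
  have "(Some l, Some r) \<in> presentation_congruence X R"
    using assms(2) generators_in_congruence unfolding presentation_congruence_def by blast
  from presentation_congruence_context[OF assms(1) this assms(3,4)]
  have *: "(Some (p @ l @ s), Some (p @ r @ s)) \<in> presentation_congruence X R" by simp
  have "trans (presentation_congruence X R)"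
    using congruence_generated[OF assms(1), of zero_append] zero_append_closed
    unfolding presentation_congruence_def congruence_on_def equiv_def by blast
  then show ?thesis
    using * assms(5) by (meson transE)
qed

text \<open>A relation used from right to left. This is how squares such as \<open>cc\<close>, on
  which the relations are silent, are seen to vanish.\<close>

lemma presentation_congruence_expand:
  assumes "R \<subseteq> free_zero_semigroup X \<times> free_zero_semigroup X"
    and "(Some l, Some r) \<in> R" "p \<in> lists X" "s \<in> lists X"
    and "(Some (p @ l @ s), n) \<in> presentation_congruence X R"
  shows "(Some (p @ r @ s), n) \<in> presentation_congruence X R"
proof -
  have "(Some l, Some r) \<in> presentation_congruence X R"
    using assms(2) generators_in_congruence unfolding presentation_congruence_def by blast
  from presentation_congruence_context[OF assms(1) this assms(3,4)]
  have *: "(Some (p @ l @ s), Some (p @ r @ s)) \<in> presentation_congruence X R" by simp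
  have "trans (presentation_congruence X R)" "sym (presentation_congruence X R)"
    using congruence_generated[OF assms(1), of zero_append] zero_append_closed
    unfolding presentation_congruence_def congruence_on_def equiv_def by blast+
  then show ?thesis
    using * assms(5) by (meson symE transE)
qed

lemma presentation_congruence_zero:
  assumes "R \<subseteq> free_zero_semigroup X \<times> free_zero_semigroup X"
    and "(Some l, None) \<in> R" "p \<in> lists X" "s \<in> lists X"
  shows "(Some (p @ l @ s), None) \<in> presentation_congruence X R"
proof -
  have "(Some l, None) \<in> presentation_congruence X R"
    using assms(2) generators_in_congruence unfolding presentation_congruence_def by blast
  from presentation_congruence_context[OF assms(1) this assms(3,4)]
  show ?thesis by simp
qed

lemma presentation_congruence_refl:
  assumes "R \<subseteq> free_zero_semigroup X \<times> free_zero_semigroup X" "w \<in> lists X" "w \<noteq> []"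
  shows "(Some w, Some w) \<in> presentation_congruence X R"
  using congruence_generated[OF assms(1), of zero_append] zero_append_closed assms(2,3)
  unfolding presentation_congruence_def congruence_on_def equiv_def refl_on_def
  by (metis Some_in_free_zero_semigroup)

text \<open>
  The words acting nontrivially are those labelling a path of a three-state automaton: the factors of
  \<open>f\<^sup>*e\<^sup>*cf\<^sup>*\<close> for \<open>A\<close> and those of \<open>e\<^sup>*bce\<^sup>*\<close> for \<open>Q\<close>.
\<close>

fun act_A :: "generator \<Rightarrow> state rel" where
  "act_A Gen_e = {(S0, S1), (S1, S1)}"
| "act_A Gen_f = {(S0, S0), (S2, S2)}"
| "act_A Gen_c = {(S0, S2), (S1, S2)}"
| "act_A Gen_b = {}"

fun act_Q :: "generator \<Rightarrow> state rel" where
  "act_Q Gen_e = {(S0, S0), (S2, S2)}"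
| "act_Q Gen_b = {(S0, S1)}"
| "act_Q Gen_c = {(S1, S2)}"
| "act_Q Gen_f = {}"

abbreviation rel_A where
  "rel_A \<equiv> {(Some [Gen_e, Gen_e], Some [Gen_e]),
      (Some [Gen_f, Gen_f], Some [Gen_f]),
      (Some [Gen_e, Gen_f], None),
      (Some [Gen_c, Gen_e], None),
      (Some [Gen_e, Gen_c], Some [Gen_c]),
      (Some [Gen_c, Gen_f], Some [Gen_c])}"

abbreviation rel_A0 where
  "rel_A0 \<equiv> {(Some [Gen_e, Gen_e], Some [Gen_e]),
      (Some [Gen_f, Gen_f], Some [Gen_f]),
      (Some [Gen_e, Gen_f], None)}"

abbreviation rel_Q where
  "rel_Q \<equiv> {(Some [Gen_e, Gen_e], Some [Gen_e]),
      (Some [Gen_e, Gen_b], Some [Gen_b]),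
      (Some [Gen_c, Gen_e], Some [Gen_c]),
      (Some [Gen_e, Gen_c], None),
      (Some [Gen_b, Gen_e], None),
      (Some [Gen_c, Gen_b], None)}"

section \<open>The three presentations and their multiplication tables\<close>

lemma generator_relcomp:
  "{(S0, S1), (S1, S1)} O {(S0, S1), (S1, S1)} = {(S0, S1), (S1, S1)}"
  "{(S0, S0), (S2, S2)} O {(S0, S0), (S2, S2)} = {(S0, S0), (S2, S2)}"
  "{(S0, S1), (S1, S1)} O {(S0, S0), (S2, S2)} = {}"
  "{(S0, S0), (S2, S2)} O {(S0, S1), (S1, S1)} = {(S0, S1)}"
  "{(S0, S1), (S1, S1)} O {(S0, S2), (S1, S2)} = {(S0, S2), (S1, S2)}"
  "{(S0, S2), (S1, S2)} O {(S0, S1), (S1, S1)} = {}"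
  "{(S0, S0), (S2, S2)} O {(S0, S2), (S1, S2)} = {(S0, S2)}"
  "{(S0, S2), (S1, S2)} O {(S0, S0), (S2, S2)} = {(S0, S2), (S1, S2)}"
  "{(S0, S0), (S2, S2)} O {(S0, S1)} = {(S0, S1)}"
  "{(S0, S1)} O {(S0, S0), (S2, S2)} = {}"
  "{(S0, S0), (S2, S2)} O {(S1, S2)} = {}"
  "{(S1, S2)} O {(S0, S0), (S2, S2)} = {(S1, S2)}"
  "{(S0, S1)} O {(S1, S2)} = {(S0, S2)}"
  "{(S1, S2)} O {(S0, S1)} = {}"
  by auto

lemma Id_neq_state_rel: "(i, i) \<notin> (r :: state rel) \<Longrightarrow> Id \<noteq> r"
  by auto

lemmas state_rel_simps = generator_relcomp set_eq_subset[of "insert _ _" "insert _ _"]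
  Id_neq_state_rel[of S0] Id_neq_state_rel[of S1]

interpretation A: presentation act_A "{Gen_e, Gen_f, Gen_c}" rel_A
  "{None, Some [Gen_e], Some [Gen_f], Some [Gen_c], Some [Gen_f, Gen_e], Some [Gen_f, Gen_c]}"
  "[Gen_e, Gen_f]"
proof -
  let ?X = "{Gen_e, Gen_f, Gen_c}"
  let ?NF = "{None, Some [Gen_e], Some [Gen_f], Some [Gen_c], Some [Gen_f, Gen_e], Some [Gen_f, Gen_c]}"
  let ?\<rho> = "presentation_congruence ?X rel_A"
  have R: "rel_A \<subseteq> free_zero_semigroup ?X \<times> free_zero_semigroup ?X"
    by (simp add: free_zero_semigroup_def image_iff)
  note rw = presentation_congruence_rewrite[OF R]
  note ex = presentation_congruence_expand[OF R]
  note zero = presentation_congruence_zero[OF R]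
  note self = presentation_congruence_refl[OF R]
  have ff: "(Some (Gen_f # Gen_f # w), n) \<in> ?\<rho>" if "(Some (Gen_f # w), n) \<in> ?\<rho>" "w \<in> lists ?X" for w n
    using rw[of "[Gen_f, Gen_f]" "[Gen_f]" "[]" w n] that by simp
  have ee: "(Some (Gen_e # Gen_e # w), n) \<in> ?\<rho>" if "(Some (Gen_e # w), n) \<in> ?\<rho>" "w \<in> lists ?X" for w n
    using rw[of "[Gen_e, Gen_e]" "[Gen_e]" "[]" w n] that by simp
  have ec: "(Some (Gen_e # Gen_c # w), n) \<in> ?\<rho>" if "(Some (Gen_c # w), n) \<in> ?\<rho>" "w \<in> lists ?X" for w n
    using rw[of "[Gen_e, Gen_c]" "[Gen_c]" "[]" w n] that by simp
  have cf: "(Some (Gen_c # Gen_f # w), n) \<in> ?\<rho>" if "(Some (Gen_c # w), n) \<in> ?\<rho>" "w \<in> lists ?X" for w n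
    using rw[of "[Gen_c, Gen_f]" "[Gen_c]" "[]" w n] that by simp
  have ef: "(Some (Gen_e # Gen_f # w), None) \<in> ?\<rho>" if "w \<in> lists ?X" for w
    using zero[of "[Gen_e, Gen_f]" "[]" w] that by simp
  have ce: "(Some (Gen_c # Gen_e # w), None) \<in> ?\<rho>" if "w \<in> lists ?X" for w
    using zero[of "[Gen_c, Gen_e]" "[]" w] that by simp
  \<comment> \<open>cc = c(ec) = (ce)c = 0.\<close>
  have cc: "(Some (Gen_c # Gen_c # w), None) \<in> ?\<rho>" if "w \<in> lists ?X" for w
    using ex[of "[Gen_e, Gen_c]" "[Gen_c]" "[Gen_c]" w None] ce[of "Gen_c # w"] that by simp
  note facts = self ff ee ec cf ef ce cc
  show "presentation act_A ?X rel_A ?NF [Gen_e, Gen_f]"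
  proof
    show "rel_A \<subseteq> free_zero_semigroup ?X \<times> free_zero_semigroup ?X" by (rule R)
    show "case_option {} (act act_A) p = case_option {} (act act_A) q" if "(p, q) \<in> rel_A" for p q
      using that by (auto simp: generator_relcomp)
    show "inj_on (case_option {} (act act_A)) ?NF"
      by (simp add: inj_on_def state_rel_simps)
    show "Id \<notin> case_option {} (act act_A) ` ?NF"
      by (simp add: state_rel_simps)
    show "\<exists>n\<in>?NF. (Some [g], n) \<in> ?\<rho>" if "g \<in> ?X" for g
    proof -
      have "g = Gen_e \<or> g = Gen_f \<or> g = Gen_c"
        using that by simp
      then show ?thesis
        by (elim disjE; simp add: facts)
    qed
    show "\<exists>n\<in>?NF. (Some (g # w), n) \<in> ?\<rho>" if "g \<in> ?X" "Some w \<in> ?NF" for g w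
    proof -
      have "g = Gen_e \<or> g = Gen_f \<or> g = Gen_c" "w = [Gen_e] \<or> w = [Gen_f] \<or> w = [Gen_c] \<or> w = [Gen_f, Gen_e] \<or> w = [Gen_f, Gen_c]"
        using that by simp_all
      then show ?thesis
        by (elim disjE; simp add: facts)
    qed
  qed (simp_all add: free_zero_semigroup_def image_iff generator_relcomp)
qed

text \<open>A_0 sits in A as the part generated by e and f. Using the same relations for both makes
  the inclusion of their identities immediate.\<close>

interpretation A0: presentation act_A "{Gen_e, Gen_f}" rel_A0
  "{None, Some [Gen_e], Some [Gen_f], Some [Gen_f, Gen_e]}"
  "[Gen_e, Gen_f]"
proof -
  let ?X = "{Gen_e, Gen_f}"
  let ?NF = "{None, Some [Gen_e], Some [Gen_f], Some [Gen_f, Gen_e]}"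
  let ?\<rho> = "presentation_congruence ?X rel_A0"
  have R: "rel_A0 \<subseteq> free_zero_semigroup ?X \<times> free_zero_semigroup ?X"
    by (simp add: free_zero_semigroup_def image_iff)
  note rw = presentation_congruence_rewrite[OF R]
  note zero = presentation_congruence_zero[OF R]
  note self = presentation_congruence_refl[OF R]
  have ff: "(Some (Gen_f # Gen_f # w), n) \<in> ?\<rho>" if "(Some (Gen_f # w), n) \<in> ?\<rho>" "w \<in> lists ?X" for w n
    using rw[of "[Gen_f, Gen_f]" "[Gen_f]" "[]" w n] that by simp
  have ee: "(Some (Gen_e # Gen_e # w), n) \<in> ?\<rho>" if "(Some (Gen_e # w), n) \<in> ?\<rho>" "w \<in> lists ?X" for w n
    using rw[of "[Gen_e, Gen_e]" "[Gen_e]" "[]" w n] that by simp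
  have ef: "(Some (Gen_e # Gen_f # w), None) \<in> ?\<rho>" if "w \<in> lists ?X" for w
    using zero[of "[Gen_e, Gen_f]" "[]" w] that by simp
  note facts = self ff ee ef
  show "presentation act_A ?X rel_A0 ?NF [Gen_e, Gen_f]"
  proof
    show "rel_A0 \<subseteq> free_zero_semigroup ?X \<times> free_zero_semigroup ?X" by (rule R)
    show "case_option {} (act act_A) p = case_option {} (act act_A) q" if "(p, q) \<in> rel_A0" for p q
      using that by (auto simp: generator_relcomp)
    show "inj_on (case_option {} (act act_A)) ?NF"
      by (simp add: inj_on_def state_rel_simps)
    show "Id \<notin> case_option {} (act act_A) ` ?NF"
      by (simp add: state_rel_simps)
    show "\<exists>n\<in>?NF. (Some [g], n) \<in> ?\<rho>" if "g \<in> ?X" for g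
    proof -
      have "g = Gen_e \<or> g = Gen_f"
        using that by simp
      then show ?thesis
        by (elim disjE; simp add: facts)
    qed
    show "\<exists>n\<in>?NF. (Some (g # w), n) \<in> ?\<rho>" if "g \<in> ?X" "Some w \<in> ?NF" for g w
    proof -
      have "g = Gen_e \<or> g = Gen_f" "w = [Gen_e] \<or> w = [Gen_f] \<or> w = [Gen_f, Gen_e]"
        using that by simp_all
      then show ?thesis
        by (elim disjE; simp add: facts)
    qed
  qed (simp_all add: free_zero_semigroup_def image_iff generator_relcomp)
qed

interpretation Q: presentation act_Q "{Gen_e, Gen_b, Gen_c}" rel_Q
  "{None, Some [Gen_e], Some [Gen_b], Some [Gen_c], Some [Gen_b, Gen_c]}"
  "[Gen_e, Gen_c]"
proof -
  let ?X = "{Gen_e, Gen_b, Gen_c}"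
  let ?NF = "{None, Some [Gen_e], Some [Gen_b], Some [Gen_c], Some [Gen_b, Gen_c]}"
  let ?\<rho> = "presentation_congruence ?X rel_Q"
  have R: "rel_Q \<subseteq> free_zero_semigroup ?X \<times> free_zero_semigroup ?X"
    by (simp add: free_zero_semigroup_def image_iff)
  note rw = presentation_congruence_rewrite[OF R]
  note ex = presentation_congruence_expand[OF R]
  note zero = presentation_congruence_zero[OF R]
  note self = presentation_congruence_refl[OF R]
  have ee: "(Some (Gen_e # Gen_e # w), n) \<in> ?\<rho>" if "(Some (Gen_e # w), n) \<in> ?\<rho>" "w \<in> lists ?X" for w n
    using rw[of "[Gen_e, Gen_e]" "[Gen_e]" "[]" w n] that by simp
  have eb: "(Some (Gen_e # Gen_b # w), n) \<in> ?\<rho>" if "(Some (Gen_b # w), n) \<in> ?\<rho>" "w \<in> lists ?X" for w n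
    using rw[of "[Gen_e, Gen_b]" "[Gen_b]" "[]" w n] that by simp
  have ce: "(Some (Gen_c # Gen_e # w), n) \<in> ?\<rho>" if "(Some (Gen_c # w), n) \<in> ?\<rho>" "w \<in> lists ?X" for w n
    using rw[of "[Gen_c, Gen_e]" "[Gen_c]" "[]" w n] that by simp
  have ec: "(Some (Gen_e # Gen_c # w), None) \<in> ?\<rho>" if "w \<in> lists ?X" for w
    using zero[of "[Gen_e, Gen_c]" "[]" w] that by simp
  have be: "(Some (Gen_b # Gen_e # w), None) \<in> ?\<rho>" if "w \<in> lists ?X" for w
    using zero[of "[Gen_b, Gen_e]" "[]" w] that by simp
  have cb: "(Some (Gen_c # Gen_b # w), None) \<in> ?\<rho>" if "w \<in> lists ?X" for w
    using zero[of "[Gen_c, Gen_b]" "[]" w] that by simp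
  \<comment> \<open>bb = b(eb) = (be)b = 0, and in the next fact cc = (ce)c = c(ec) = 0.\<close>
  have bb: "(Some (Gen_b # Gen_b # w), None) \<in> ?\<rho>" if "w \<in> lists ?X" for w
    using ex[of "[Gen_e, Gen_b]" "[Gen_b]" "[Gen_b]" w None] be[of "Gen_b # w"] that by simp
  have cc: "(Some (Gen_c # Gen_c # w), None) \<in> ?\<rho>" if "w \<in> lists ?X" for w
    using ex[of "[Gen_c, Gen_e]" "[Gen_c]" "[]" "Gen_c # w" None] zero[of "[Gen_e, Gen_c]" "[Gen_c]" w] that by simp
  note facts = self ee eb ce ec be cb bb cc
  show "presentation act_Q ?X rel_Q ?NF [Gen_e, Gen_c]"
  proof
    show "rel_Q \<subseteq> free_zero_semigroup ?X \<times> free_zero_semigroup ?X" by (rule R)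
    show "case_option {} (act act_Q) p = case_option {} (act act_Q) q" if "(p, q) \<in> rel_Q" for p q
      using that by (auto simp: generator_relcomp)
    show "inj_on (case_option {} (act act_Q)) ?NF"
      by (simp add: inj_on_def state_rel_simps)
    show "Id \<notin> case_option {} (act act_Q) ` ?NF"
      by (simp add: state_rel_simps)
    show "\<exists>n\<in>?NF. (Some [g], n) \<in> ?\<rho>" if "g \<in> ?X" for g
    proof -
      have "g = Gen_e \<or> g = Gen_b \<or> g = Gen_c"
        using that by simp
      then show ?thesis
        by (elim disjE; simp add: facts)
    qed
    show "\<exists>n\<in>?NF. (Some (g # w), n) \<in> ?\<rho>" if "g \<in> ?X" "Some w \<in> ?NF" for g w
    proof -
      have "g = Gen_e \<or> g = Gen_b \<or> g = Gen_c" "w = [Gen_e] \<or> w = [Gen_b] \<or> w = [Gen_c] \<or> w = [Gen_b, Gen_c]"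
        using that by simp_all
      then show ?thesis
        by (elim disjE; simp add: facts)
    qed
  qed (simp_all add: free_zero_semigroup_def image_iff generator_relcomp)
qed

lemma var_A_eq: "(var_A :: 'x monoid set) = models (ids act_A {Gen_e, Gen_f, Gen_c})"
  and var_A0_eq: "(var_A0 :: 'x monoid set) = models (ids act_A {Gen_e, Gen_f})"
  and var_Q_eq: "(var_Q :: 'x monoid set) = models (ids act_Q {Gen_e, Gen_b, Gen_c})"
proof -
  have "satisfies A_one p \<longleftrightarrow> p \<in> ids act_A {Gen_e, Gen_f, Gen_c}"
    "satisfies A0_one p \<longleftrightarrow> p \<in> ids act_A {Gen_e, Gen_f}"
    "satisfies Q_one p \<longleftrightarrow> p \<in> ids act_Q {Gen_e, Gen_b, Gen_c}" for p
    using A.satisfies_iff[of "fst p" "snd p"] A0.satisfies_iff[of "fst p" "snd p"]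
      Q.satisfies_iff[of "fst p" "snd p"]
    by (simp_all add: A_one_def A0_one_def Q_one_def)
  then show "(var_A :: 'x monoid set) = models (ids act_A {Gen_e, Gen_f, Gen_c})"
    "(var_A0 :: 'x monoid set) = models (ids act_A {Gen_e, Gen_f})"
    "(var_Q :: 'x monoid set) = models (ids act_Q {Gen_e, Gen_b, Gen_c})"
    by (simp_all add: var_A_def var_A0_def var_Q_def variety_generated_by_eq)
qed

section \<open>Subsequences and identities\<close>

text \<open>Scattered subsequences \<open>yz\<close> and, in \<open>sub3\<close>,
  \<open>xyz\<close>; the letters may coincide.\<close>

primrec sub2 :: "'a \<Rightarrow> 'a \<Rightarrow> 'a list \<Rightarrow> bool" where
  "sub2 y z [] = False"
| "sub2 y z (a # u) = ((y = a \<and> z \<in> set u) \<or> sub2 y z u)"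

primrec sub3 :: "'a \<Rightarrow> 'a \<Rightarrow> 'a \<Rightarrow> 'a list \<Rightarrow> bool" where
  "sub3 x y z [] = False"
| "sub3 x y z (a # u) = ((x = a \<and> sub2 y z u) \<or> sub3 x y z u)"

lemma sub2_append [simp]:
  "sub2 y z (u @ v) \<longleftrightarrow> sub2 y z u \<or> sub2 y z v \<or> (y \<in> set u \<and> z \<in> set v)"
  by (induction u) auto

lemma sub3_append [simp]:
  "sub3 x y z (u @ v) \<longleftrightarrow> sub3 x y z u \<or> sub3 x y z v \<or>
    (sub2 x y u \<and> z \<in> set v) \<or> (x \<in> set u \<and> sub2 y z v)"
  by (induction u) auto

lemma sub2_set: "sub2 y z u \<Longrightarrow> y \<in> set u \<and> z \<in> set u"
  by (induction u) auto

lemma sub3_imp2: "sub3 x y z u \<Longrightarrow> sub2 x y u \<and> sub2 x z u \<and> sub2 y z u"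
  by (induction u) (auto dest: sub2_set)

lemma sub2_rev [simp]: "sub2 y z (rev u) \<longleftrightarrow> sub2 z y u"
  by (induction u) auto

lemma sub3_rev [simp]: "sub3 x y z (rev u) \<longleftrightarrow> sub3 z y x u"
  by (induction u) (auto dest: sub2_set)

lemma simple_split:
  assumes "x \<in> set u" "\<not> sub2 x x u"
  obtains p q where "u = p @ x # q" "x \<notin> set p" "x \<notin> set q"
proof -
  obtain p q where "u = p @ x # q"
    using assms(1) by (meson split_list)
  with assms(2) that show ?thesis by auto
qed

text \<open>A letter \<open>x\<close> is multiple in \<open>w\<close> iff \<open>sub2 x x w\<close>.\<close>

definition agree2 :: "word \<Rightarrow> word \<Rightarrow> bool" where
  "agree2 u v \<longleftrightarrow> set u = set v \<and> (\<forall>y z. sub2 y z u \<longleftrightarrow> sub2 y z v)"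

text \<open>For simple x and z the clauses fix what stands before x, after x and between x and z,
  that is, the order of the simple letters and the content of every block. The condition is
  invariant under reversal, so it can serve both A and its dual.\<close>

definition agree_Q :: "word \<Rightarrow> word \<Rightarrow> bool" where
  "agree_Q u v \<longleftrightarrow> set u = set v \<and> (\<forall>x. sub2 x x u \<longleftrightarrow> sub2 x x v) \<and>
    (\<forall>x y. \<not> sub2 x x u \<longrightarrow>
      (sub2 x y u \<longleftrightarrow> sub2 x y v) \<and> (sub2 y x u \<longleftrightarrow> sub2 y x v)) \<and>
    (\<forall>x y z. \<not> sub2 x x u \<longrightarrow> \<not> sub2 z z u \<longrightarrow>
      (sub3 x y z u \<longleftrightarrow> sub3 x y z v))"

text \<open>Sufficient for an identity of A. Conversely, \<open>ids_A_sub3\<close> recovers the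
  triples \<open>yzx\<close> only for y that does not recur after x.\<close>

definition agree_A :: "word \<Rightarrow> word \<Rightarrow> bool" where
  "agree_A u v \<longleftrightarrow> agree2 u v \<and>
    (\<forall>x y z. \<not> sub2 x x u \<longrightarrow> (sub3 y z x u \<longleftrightarrow> sub3 y z x v))"

lemma agree_A_sym: "agree_A u v \<Longrightarrow> agree_A v u"
  by (auto simp: agree_A_def agree2_def)

lemma agree2_rev: "agree2 (rev u) (rev v) \<longleftrightarrow> agree2 u v"
  by (auto simp: agree2_def)

lemma agree_Q_rev: "agree_Q (rev u) (rev v) \<longleftrightarrow> agree_Q u v"
  unfolding agree_Q_def by (simp; blast)

section \<open>Relations that never lower the state\<close>

abbreviation upper_triangular :: "state rel" where
  "upper_triangular \<equiv> {(S0, S0), (S0, S1), (S0, S2), (S1, S1), (S1, S2), (S2, S2)}"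

lemma upper_triangular_Id: "Id \<subseteq> upper_triangular"
proof (rule subrelI)
  fix i j :: state assume "(i, j) \<in> Id"
  then show "(i, j) \<in> upper_triangular" by (cases i) auto
qed

lemma upper_triangular_act:
  assumes tri: "\<And>x. R x \<subseteq> upper_triangular"
  shows "act R u \<subseteq> upper_triangular"
proof (induction u)
  case Nil
  then show ?case using upper_triangular_Id by simp
next
  case (Cons x u)
  show ?case
  proof (rule subrelI)
    fix i j assume "(i, j) \<in> act R (x # u)"
    then obtain k where "(i, k) \<in> R x" "(k, j) \<in> act R u" by auto
    then have "(i, k) \<in> upper_triangular" "(k, j) \<in> upper_triangular"
      using tri[of x] Cons by blast+
    then show "(i, j) \<in> upper_triangular" by auto
  qed
qed

text \<open>States never decrease along a path, so a path from i back to i stays at i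
  throughout.\<close>

lemma diagonal_act:
  assumes tri: "\<And>x. R x \<subseteq> upper_triangular"
  shows "(i, i) \<in> act R u \<longleftrightarrow> (\<forall>x\<in>set u. (i, i) \<in> R x)"
proof (induction u)
  case (Cons x u)
  have "k = i" if "(i, k) \<in> R x" "(k, i) \<in> act R u" for k
  proof -
    have "(i, k) \<in> upper_triangular" "(k, i) \<in> upper_triangular"
      using that tri[of x] upper_triangular_act[of R u, OF tri] by blast+
    then show ?thesis by auto
  qed
  then have "(i, i) \<in> act R (x # u) \<longleftrightarrow> (i, i) \<in> R x \<and> (i, i) \<in> act R u"
    by auto
  then show ?case using Cons by simp
qed simp

lemma first_visit_S2:
  assumes "(i, S2) \<in> act R u" "i \<noteq> S2"
  shows "\<exists>p x q k. u = p @ x # q \<and> (i, k) \<in> act R p \<and> k \<noteq> S2 \<and> (k, S2) \<in> R x \<and> (S2, S2) \<in> act R q"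
  using assms
proof (induction u arbitrary: i)
  case (Cons x u)
  then obtain k where k: "(i, k) \<in> R x" "(k, S2) \<in> act R u" by auto
  show ?case
  proof (cases "k = S2")
    case True
    then show ?thesis
      using k Cons.prems by (intro exI[of _ "[]"] exI[of _ x] exI[of _ u] exI[of _ i]) simp
  next
    case False
    from Cons.IH[OF k(2) this] obtain p y q l where
      "u = p @ y # q" "(k, l) \<in> act R p" "l \<noteq> S2" "(l, S2) \<in> R y" "(S2, S2) \<in> act R q"
      by blast
    then show ?thesis
      using k by (intro exI[of _ "x # p"] exI[of _ y] exI[of _ q] exI[of _ l]) auto
  qed
qed simp

text \<open>The seven relations are the actions of the elements of A^1. A path from S0 to S1 is
  governed by pairs of letters. A path entering S2 does so at a letter x that must be simple; the
  pairs before x are then the triples ending in x, and of the letters after x only the set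
  matters.\<close>

lemma agree_A_act:
  assumes R: "\<And>x. R x \<in> {Id, {}, {(S0, S1), (S1, S1)}, {(S0, S0), (S2, S2)},
      {(S0, S2), (S1, S2)}, {(S0, S1)}, {(S0, S2)}}"
    and agree: "agree_A u v"
  shows "act R u \<subseteq> act R v"
proof -
  have tri: "R x \<subseteq> upper_triangular" for x
    using R[of x] upper_triangular_Id by (elim insertE) simp_all
  note tri_act = upper_triangular_act[of R, OF tri] and diag = diagonal_act[of R, OF tri]
  have to_S2: "(S0, S0) \<notin> R x \<and> (S0, S1) \<notin> R x \<and> (S1, S1) \<notin> R x \<and> (S2, S2) \<notin> R x"
    if "(k, S2) \<in> R x" "k \<noteq> S2" for k x
    using R[of x] that by auto
  have stay: "(S0, S0) \<notin> R x" if "(S0, S1) \<in> R x" for x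
    using R[of x] that by auto
  have loop_S1: "(S0, S0) \<in> R x \<or> (S0, S1) \<in> R x" if "(S1, S1) \<in> R x" for x
    using R[of x] that by auto
  \<comment> \<open>Such a path has to leave S0 at the first letter without a loop at S0, and all
    later letters must loop at S1. Only the content and the pairs of the word enter.\<close>
  have cross: "(S0, S1) \<in> act R w \<longleftrightarrow> (\<forall>x\<in>set w. (S0, S0) \<in> R x \<or> (S0, S1) \<in> R x) \<and>
    (\<exists>x\<in>set w. (S0, S0) \<notin> R x) \<and> (\<forall>y z. sub2 y z w \<longrightarrow> (S0, S0) \<in> R y \<or> (S1, S1) \<in> R z)" for w
  proof (induction w)
    case (Cons x w)
    have "(S0, S1) \<in> act R (x # w) \<longleftrightarrow>
        (S0, S0) \<in> R x \<and> (S0, S1) \<in> act R w \<or> (S0, S1) \<in> R x \<and> (\<forall>y\<in>set w. (S1, S1) \<in> R y)"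
    proof -
      have "(S2, S1) \<notin> act R w"
        using tri_act[of w] by auto
      moreover have "(S0, S1) \<in> act R (x # w) \<longleftrightarrow> (\<exists>k. (S0, k) \<in> R x \<and> (k, S1) \<in> act R w)"
        by auto
      moreover have "(\<exists>k. P k) \<longleftrightarrow> P S0 \<or> P S1 \<or> P S2" for P
        by (metis state.exhaust)
      ultimately show ?thesis
        by (simp add: diag)
    qed
    moreover have "\<forall>y\<in>set w. (S0, S0) \<in> R y \<or> (S0, S1) \<in> R y"
      and "\<And>y z. sub2 y z w \<Longrightarrow> (S1, S1) \<in> R z" if "\<forall>y\<in>set w. (S1, S1) \<in> R y"
      using that loop_S1 by (blast dest: sub2_set)+
    ultimately show ?case
      using stay[of x] by (cases "(S0, S0) \<in> R x") (simp add: Cons; blast)+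
  qed simp
  have same: "agree2 u v"
    and same3: "\<And>x y z. \<not> sub2 x x u \<Longrightarrow> sub3 y z x u \<longleftrightarrow> sub3 y z x v"
    using agree by (simp_all add: agree_A_def)
  then have set: "set u = set v" and same2: "\<And>y z. sub2 y z u \<longleftrightarrow> sub2 y z v"
    by (simp_all add: agree2_def)
  have visit: "(i, S2) \<in> act R v" if iu: "(i, S2) \<in> act R u" "i \<noteq> S2" for i
  proof -
    obtain p x q k where u: "u = p @ x # q" and p: "(i, k) \<in> act R p" "k \<noteq> S2"
      and x: "(k, S2) \<in> R x" and q: "(S2, S2) \<in> act R q"
      using first_visit_S2[OF iu] by blast
    \<comment> \<open>A letter leading into S2 from elsewhere has no loop and no edge from S0 to S1,
      so the path cannot read it a second time, neither before nor after.\<close>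
    have xp: "x \<notin> set p"
    proof
      assume "x \<in> set p"
      moreover have "(i, k) = (S0, S0) \<or> (i, k) = (S0, S1) \<or> (i, k) = (S1, S1)"
        using p subsetD[OF tri_act[of p] p(1)] by auto
      ultimately show False
        using p(1) to_S2[OF x p(2)] diag[of i p] cross[of p] by (elim disjE) auto
    qed
    have xq: "x \<notin> set q"
      using q to_S2[OF x p(2)] diag[of S2 q] by auto
    have xx: "\<not> sub2 x x v"
      using same2[of x x] xp xq u by (auto dest: sub2_set)
    have "x \<in> set v"
      using set u by auto
    then obtain p' q' where v: "v = p' @ x # q'" "x \<notin> set p'" "x \<notin> set q'"
      using xx by (rule simple_split)
    have "y \<in> set p \<longleftrightarrow> y \<in> set p'" "y \<in> set q \<longleftrightarrow> y \<in> set q'" for y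
      using same2[of y x] same2[of x y] u v xp xq by (auto dest: sub2_set)
    then have set_p: "set p = set p'" and set_q: "set q = set q'"
      by blast+
    \<comment> \<open>As x occurs once, the pairs in the prefix are exactly the triples ending in
      x.\<close>
    have "sub2 y z p \<longleftrightarrow> sub2 y z p'" for y z
    proof -
      have "\<not> sub2 x x u"
        using u xp xq by (auto dest: sub2_set)
      moreover have "sub3 y z x (p @ x # q) \<longleftrightarrow> sub2 y z p"
        "sub3 y z x (p' @ x # q') \<longleftrightarrow> sub2 y z p'"
        using xp xq v by (auto dest: sub2_set sub3_imp2)
      ultimately show ?thesis
        using same3[of x y z] u v by simp
    qed
    then have "(S0, S1) \<in> act R p \<longleftrightarrow> (S0, S1) \<in> act R p'"
      using set_p unfolding cross by simp
    moreover have "(j, j) \<in> act R p \<longleftrightarrow> (j, j) \<in> act R p'" for j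
      using set_p by (simp add: diag)
    ultimately have "(i, k) \<in> act R p'"
      using p subsetD[OF tri_act[of p] p(1)] by auto
    moreover have "(S2, S2) \<in> act R q'"
      using q set_q by (simp add: diag)
    ultimately show ?thesis
      using x v by auto
  qed
  show ?thesis
  proof
    fix e assume e: "e \<in> act R u"
    obtain i j where ij: "e = (i, j)" by fastforce
    consider "i = j" | "i = S0" "j = S1" | "i \<noteq> S2" "j = S2"
      using e ij subsetD[OF tri_act[of u] e] by auto
    then show "e \<in> act R v"
    proof cases
      case 1
      then show ?thesis using e ij set by (simp add: diag)
    next
      case 2
      then show ?thesis using e ij set same2 by (simp add: cross)
    next
      case 3
      then show ?thesis using e ij visit by simp
    qed
  qed
qed

lemma agree_A_imp_ids: "agree_A u v \<Longrightarrow> (u, v) \<in> ids act_A {Gen_e, Gen_f, Gen_c}"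
  unfolding ids_def
proof clarify
  fix \<theta> :: "letter \<Rightarrow> generator list"
  assume agree: "agree_A u v" and \<theta>: "\<forall>x. \<theta> x \<in> lists {Gen_e, Gen_f, Gen_c}"
  have "act act_A (\<theta> x) \<in> {Id, {}, {(S0, S1), (S1, S1)}, {(S0, S0), (S2, S2)},
      {(S0, S2), (S1, S2)}, {(S0, S1)}, {(S0, S2)}}" for x
    using A.act_in_NF[of "\<theta> x"] \<theta> by (cases "\<theta> x = []") (auto simp: generator_relcomp)
  then show "act act_A (subst \<theta> u) = act act_A (subst \<theta> v)"
    unfolding act_subst
    by (intro subset_antisym agree_A_act agree agree_A_sym)
qed

lemma (in presentation) ids_set:
  assumes "(u, v) \<in> ids \<tau> X"
  shows "set u = set v"
proof -
  have "a \<in> set u \<longleftrightarrow> a \<in> set v" for a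
  proof -
    \<comment> \<open>All letters but one are erased, and that one becomes the nonempty word
      \<open>z\<close>; the result is empty, hence acts as \<open>Id\<close>, iff the letter is
      absent.\<close>
    define \<theta> :: "letter \<Rightarrow> 'g list" where "\<theta> x = (if x = a then z else [])" for x
    have \<theta>: "\<theta> x \<in> lists X" for x
      using z by (simp add: \<theta>_def)
    have "act \<tau> (subst \<theta> w) = Id \<longleftrightarrow> a \<notin> set w" for w
    proof -
      have "act \<tau> (subst \<theta> w) = Id \<longleftrightarrow> subst \<theta> w = []"
        by (rule act_eq_Id_iff) (rule subst_in_lists, rule \<theta>)
      also have "\<dots> \<longleftrightarrow> a \<notin> set w"
        using z by (auto simp: \<theta>_def)
      finally show ?thesis .
    qed
    then show ?thesis
      using idsD[OF assms, of \<theta>] \<theta> by metis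
  qed
  then show ?thesis by auto
qed

section \<open>What the identities of the three semigroups force on subsequences\<close>

lemma in_relcomp_iff: "(i, j) \<in> r O s \<longleftrightarrow> (\<exists>k. (i, k) \<in> r \<and> (k, j) \<in> s)"
  by auto

lemma ex_state: "(\<exists>k. P k) \<longleftrightarrow> P S0 \<or> P S1 \<or> P S2"
  by (metis state.exhaust)

lemma ids_A0_imp_agree2:
  assumes "(u, v) \<in> ids act_A {Gen_e, Gen_f}"
  shows "agree2 u v"
proof -
  have "sub2 y z u \<longleftrightarrow> sub2 y z v" for y z
  proof -
    \<comment> \<open>Here y becomes e and z becomes f; since ef = 0, paths from S0 die exactly when
      \<open>yz\<close> is a subsequence. For y = z the value is fe, whose square is zero, so the
      same test detects a multiple letter.\<close>
    define \<theta> where "\<theta> x = (if x = z then [Gen_f] else []) @ (if x = y then [Gen_e] else [])" for x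
    have \<theta>: "\<theta> x \<in> lists {Gen_e, Gen_f}" for x
      by (simp add: \<theta>_def)
    define R where "R = (\<lambda>x. act act_A (\<theta> x))"
    have R: "R x = (if x = z then if x = y then {(S0, S1)} else {(S0, S0), (S2, S2)} else if x = y then {(S0, S1), (S1, S1)} else Id)" for x
      by (auto simp: R_def \<theta>_def)
    have act: "act act_A (subst \<theta> w) = act R w" for w
      by (simp add: act_subst R_def)
    have eq: "act R u = act R v"
      using idsD[OF assms, of \<theta>, OF \<theta>] by (simp only: act)
    have S1: "(\<exists>j. (S1, j) \<in> act R w) \<longleftrightarrow> z \<notin> set w" for w
    proof (induction w)
      case (Cons a w)
      then show ?case
        by (auto simp: R[of a] in_relcomp_iff ex_state)
    qed simp
    have "(\<exists>j. (S0, j) \<in> act R w) \<longleftrightarrow> \<not> sub2 y z w" for w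
    proof (induction w)
      case (Cons a w)
      show ?case
        using Cons S1[of w] sub2_set[of y z w]
        by (auto simp: R[of a] in_relcomp_iff ex_state)
    qed simp
    from this[of u] this[of v] show ?thesis
      using eq by simp
  qed
  then show ?thesis
    using A0.ids_set[OF assms] by (simp add: agree2_def)
qed

lemma ids_A_subset_A0: "ids act_A {Gen_e, Gen_f, Gen_c} \<subseteq> ids act_A {Gen_e, Gen_f}"
proof -
  have "lists {Gen_e, Gen_f} \<subseteq> lists {Gen_e, Gen_f, Gen_c}"
    by (rule lists_mono) auto
  then show ?thesis
    unfolding ids_def by blast
qed

text \<open>Put c for x, e for y and f for z. As cc = ce = ef = 0, a path from S0 to S2 survives iff
  x occurs exactly once, y does not follow it, and \<open>yzx\<close> is no subsequence. If y
  followed x, both sides would vanish and the triple would stay invisible.\<close>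

lemma ids_A_sub3:
  assumes uv: "(u, v) \<in> ids act_A {Gen_e, Gen_f, Gen_c}"
    and xyz: "distinct [x, y, z]" and u: "\<not> sub2 x x u" "\<not> sub2 x y u"
  shows "sub3 y z x u \<longleftrightarrow> sub3 y z x v"
proof -
  have agree: "agree2 u v"
    using uv ids_A_subset_A0 ids_A0_imp_agree2 by blast
  define \<theta> where "\<theta> a = (if a = x then [Gen_c] else if a = y then [Gen_e] else if a = z then [Gen_f] else [])" for a
  have \<theta>: "\<theta> a \<in> lists {Gen_e, Gen_f, Gen_c}" for a
    by (simp add: \<theta>_def)
  define R where "R = (\<lambda>a. act act_A (\<theta> a))"
  have R: "R a = (if a = x then {(S0, S2), (S1, S2)} else if a = y then {(S0, S1), (S1, S1)} else if a = z then {(S0, S0), (S2, S2)} else Id)" for a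
    by (auto simp: R_def \<theta>_def)
  have act: "act act_A (subst \<theta> w) = act R w" for w
    by (simp add: act_subst R_def)
  have eq: "act R u = act R v"
    using idsD[OF uv, of \<theta>, OF \<theta>] by (simp only: act)
  have S2: "(S2, S2) \<in> act R w \<longleftrightarrow> x \<notin> set w \<and> y \<notin> set w" for w
  proof (induction w)
    case (Cons a w)
    then show ?case
      using xyz by (auto simp: R[of a] in_relcomp_iff ex_state)
  qed simp
  have S1: "(S1, S2) \<in> act R w \<longleftrightarrow>
      x \<in> set w \<and> \<not> sub2 x x w \<and> \<not> sub2 x y w \<and> \<not> sub2 z x w" for w
  proof (induction w)
    case (Cons a w)
    show ?case
      using xyz Cons S2[of w] sub2_set[of x x w] sub2_set[of x y w] sub2_set[of z x w]
      by (auto simp: R[of a] in_relcomp_iff ex_state)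
  qed simp
  have "(S0, S2) \<in> act R w \<longleftrightarrow>
      x \<in> set w \<and> \<not> sub2 x x w \<and> \<not> sub2 x y w \<and> \<not> sub3 y z x w" for w
  proof (induction w)
    case (Cons a w)
    show ?case
      using xyz Cons S2[of w] S1[of w] sub2_set[of x x w] sub2_set[of x y w] sub3_imp2[of y z x w]
        sub2_set[of z x w]
      by (auto simp: R[of a] in_relcomp_iff ex_state)
  qed simp
  from this[of u] this[of v] show ?thesis
    using eq agree u sub3_imp2[of y z x u] sub3_imp2[of y z x v] sub2_set[of z x u] sub2_set[of z x v]
    unfolding agree2_def by auto
qed

text \<open>If both outer letters of a triple are simple, the first cannot recur after the last,
  which is the side condition of \<open>ids_A_sub3\<close>.\<close>

lemma ids_A_imp_agree_Q:
  assumes uv: "(u, v) \<in> ids act_A {Gen_e, Gen_f, Gen_c}"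
  shows "agree_Q u v"
proof -
  have imp: "sub3 x y z v" if uv: "(u, v) \<in> ids act_A {Gen_e, Gen_f, Gen_c}"
    and simple: "\<not> sub2 x x u" "\<not> sub2 z z u" and sub3: "sub3 x y z u" for u v x y z
  proof -
    have *: "sub2 x y u" "sub2 x z u" "sub2 y z u"
      using sub3 by (auto dest: sub3_imp2)
    then have xyz: "distinct [z, x, y]"
      using simple by auto
    have "\<not> sub2 z x u"
    proof
      assume "sub2 z x u"
      have "x \<in> set u"
        using *(1) by (auto dest: sub2_set)
      then obtain p q where u: "u = p @ x # q" "x \<notin> set p" "x \<notin> set q"
        using simple(1) by (rule simple_split)
      then show False
        using \<open>sub2 z x u\<close> *(2) simple(2) xyz by (auto dest: sub2_set)
    qed
    then show ?thesis
      using ids_A_sub3[OF uv xyz simple(2)] sub3 by simp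
  qed
  have agree: "agree2 u v"
    using uv ids_A_subset_A0 ids_A0_imp_agree2 by blast
  then have "sub3 x y z u \<longleftrightarrow> sub3 x y z v" if "\<not> sub2 x x u" "\<not> sub2 z z u" for x y z
    using imp[OF uv that] imp[OF ids_sym[OF uv], of x z y] that unfolding agree2_def by blast
  then show ?thesis
    using agree unfolding agree_Q_def agree2_def by simp
qed

text \<open>With b for x and e for y, bb = be = 0 detects x or y after x; with c for x, cc = ec = 0
  detects them before x. With b and c for two simple letters and e for y, the value bc survives
  unless y stands between them.\<close>

lemma ids_Q_imp_agree_Q:
  assumes uv: "(u, v) \<in> ids act_Q {Gen_e, Gen_b, Gen_c}"
  shows "agree_Q u v"
proof -
  have right: "\<not> sub2 x x u \<and> \<not> sub2 x y u \<longleftrightarrow> \<not> sub2 x x v \<and> \<not> sub2 x y v" for x y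
  proof -
    define \<theta> where "\<theta> a = (if a = x then [Gen_b] else if a = y then [Gen_e] else [])" for a
    have \<theta>: "\<theta> a \<in> lists {Gen_e, Gen_b, Gen_c}" for a
      by (simp add: \<theta>_def)
    define R where "R = (\<lambda>a. act act_Q (\<theta> a))"
    have R: "R a = (if a = x then {(S0, S1)} else if a = y then {(S0, S0), (S2, S2)} else Id)" for a
      by (auto simp: R_def \<theta>_def)
    have act: "act act_Q (subst \<theta> w) = act R w" for w
      by (simp add: act_subst R_def)
    have eq: "act R u = act R v"
      using idsD[OF uv, of \<theta>, OF \<theta>] by (simp only: act)
    have S1: "(\<exists>j. (S1, j) \<in> act R w) \<longleftrightarrow> x \<notin> set w \<and> y \<notin> set w" for w
    proof (induction w)
      case (Cons a w)
      then show ?case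
        by (auto simp: R[of a] in_relcomp_iff ex_state)
    qed simp
    have "(\<exists>j. (S0, j) \<in> act R w) \<longleftrightarrow> \<not> sub2 x x w \<and> \<not> sub2 x y w" for w
    proof (induction w)
      case (Cons a w)
      show ?case
        using Cons S1[of w] sub2_set[of x x w] sub2_set[of x y w]
        by (auto simp: R[of a] in_relcomp_iff ex_state)
    qed simp
    from this[of u] this[of v] show ?thesis
      using eq by simp
  qed
  \<comment> \<open>The mirror image: the paths ending in S2 are followed from the right end of the
    word.\<close>
  have left: "\<not> sub2 x x u \<and> \<not> sub2 y x u \<longleftrightarrow> \<not> sub2 x x v \<and> \<not> sub2 y x v" for x y
  proof -
    define \<theta> where "\<theta> a = (if a = x then [Gen_c] else if a = y then [Gen_e] else [])" for a
    have \<theta>: "\<theta> a \<in> lists {Gen_e, Gen_b, Gen_c}" for a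
      by (simp add: \<theta>_def)
    define R where "R = (\<lambda>a. act act_Q (\<theta> a))"
    have R: "R a = (if a = x then {(S1, S2)} else if a = y then {(S0, S0), (S2, S2)} else Id)" for a
      by (auto simp: R_def \<theta>_def)
    have act: "act act_Q (subst \<theta> w) = act R w" for w
      by (simp add: act_subst R_def)
    have eq: "act R u = act R v"
      using idsD[OF uv, of \<theta>, OF \<theta>] by (simp only: act)
    have S1: "(\<exists>j. (j, S1) \<in> act R w) \<longleftrightarrow> x \<notin> set w \<and> y \<notin> set w" for w
    proof (induction w rule: rev_induct)
      case (snoc a w)
      then show ?case
        by (auto simp: R[of a] in_relcomp_iff ex_state)
    qed simp
    have "(\<exists>j. (j, S2) \<in> act R w) \<longleftrightarrow> \<not> sub2 x x w \<and> \<not> sub2 y x w" for w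
    proof (induction w rule: rev_induct)
      case (snoc a w)
      show ?case
        using snoc S1[of w] sub2_set[of x x w] sub2_set[of y x w]
        by (auto simp: R[of a] in_relcomp_iff ex_state)
    qed simp
    from this[of u] this[of v] show ?thesis
      using eq by simp
  qed
  have set: "set u = set v"
    using uv by (rule Q.ids_set)
  have mult: "sub2 x x u \<longleftrightarrow> sub2 x x v" for x
    using right[of x x] by blast
  have block: "sub3 x y z v"
    if uv: "(u, v) \<in> ids act_Q {Gen_e, Gen_b, Gen_c}"
      and mult: "\<And>x. sub2 x x u \<longleftrightarrow> sub2 x x v"
      and two: "\<And>y. sub2 x y u \<longleftrightarrow> sub2 x y v"
      and u: "\<not> sub2 x x u" "\<not> sub2 z z u" "sub3 x y z u" for u v x y z
  proof (rule ccontr)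
    assume v: "\<not> sub3 x y z v"
    have *: "sub2 x y u" "sub2 x z u" "sub2 y z u"
      using u(3) by (auto dest: sub3_imp2)
    then have xyz: "distinct [x, y, z]"
      using u by auto
    define \<theta> where "\<theta> a = (if a = x then [Gen_b] else if a = z then [Gen_c] else if a = y then [Gen_e] else [])" for a
    have \<theta>: "\<theta> a \<in> lists {Gen_e, Gen_b, Gen_c}" for a
      by (simp add: \<theta>_def)
    define R where "R = (\<lambda>a. act act_Q (\<theta> a))"
    have R: "R a = (if a = x then {(S0, S1)} else if a = z then {(S1, S2)} else if a = y then {(S0, S0), (S2, S2)} else Id)" for a
      by (auto simp: R_def \<theta>_def)
    have act: "act act_Q (subst \<theta> w) = act R w" for w
      by (simp add: act_subst R_def)
    have eq: "act R u = act R v"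
      using idsD[OF uv, of \<theta>, OF \<theta>] by (simp only: act)
    have S2: "(S2, S2) \<in> act R w \<longleftrightarrow> x \<notin> set w \<and> z \<notin> set w" for w
    proof (induction w)
      case (Cons a w)
      then show ?case
        using xyz by (auto simp: R[of a] in_relcomp_iff ex_state)
    qed simp
    have S1: "(S1, S2) \<in> act R w \<longleftrightarrow>
        z \<in> set w \<and> x \<notin> set w \<and> \<not> sub2 z z w \<and> \<not> sub2 y z w" for w
    proof (induction w)
      case (Cons a w)
      show ?case
        using xyz Cons S2[of w] sub2_set[of z z w] sub2_set[of y z w]
        by (auto simp: R[of a] in_relcomp_iff ex_state)
    qed simp
    have "(S0, S2) \<in> act R w \<longleftrightarrow>
        sub2 x z w \<and> \<not> sub2 x x w \<and> \<not> sub2 z z w \<and> \<not> sub3 x y z w" for w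
    proof (induction w)
      case (Cons a w)
      show ?case
        using xyz Cons S1[of w] sub2_set[of x z w] sub2_set[of x x w] sub2_set[of z z w]
          sub3_imp2[of x y z w]
        by (auto simp: R[of a] in_relcomp_iff ex_state)
    qed simp
    from this[of u] this[of v] have "sub2 x z u \<and> \<not> sub2 x x u \<and> \<not> sub2 z z u \<and> \<not> sub3 x y z u \<longleftrightarrow>
        sub2 x z v \<and> \<not> sub2 x x v \<and> \<not> sub2 z z v \<and> \<not> sub3 x y z v"
      using eq by simp
    then show False
      using u v * mult two by simp
  qed
  have "sub3 x y z u \<longleftrightarrow> sub3 x y z v" if "\<not> sub2 x x u" "\<not> sub2 z z u" for x y z
  proof
    show "sub3 x y z u \<Longrightarrow> sub3 x y z v"
      using block[OF uv, of x z y] mult right[of x] that by blast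
    show "sub3 x y z v \<Longrightarrow> sub3 x y z u"
      using block[OF ids_sym[OF uv], of x z y] mult right[of x] that by blast
  qed
  then show ?thesis
    using set mult right left unfolding agree_Q_def by blast
qed

section \<open>Saturated words and the meet\<close>

text \<open>
  Insertions of a letter \<open>z\<close> at the end of a block in which it occurs and after which it occurs
  again are invisible to the dual of \<open>\<AA>\<close>; a saturated word already has the subsequences \<open>yzt\<close>
  which they would create.
\<close>

definition saturated :: "word \<Rightarrow> bool" where
  "saturated w \<longleftrightarrow> (\<forall>p z q t r y. w = p @ z # q @ t # r \<longrightarrow> \<not> sub2 t t w \<longrightarrow>
     (\<forall>s\<in>set (z # q). sub2 s s w) \<longrightarrow> z \<in> set r \<longrightarrow> y \<in> set (p @ z # q) \<longrightarrow> sub3 y z t w)"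

text \<open>All letters of \<open>z # q\<close> are multiple, so a simple x lies outside. In a pair
  or in a triple starting with x, the new z can be replaced by the z already in the block if
  something follows it, and by a z of \<open>r\<close> if it comes last. Reversal turns the triples
  ending in a simple letter, as in \<open>agree_A\<close>, into triples starting with one.\<close>

lemma agree_A_rev_insert:
  assumes w: "w = p @ z # q @ t # r" and z: "z \<in> set r"
    and q: "\<forall>s\<in>set (z # q). sub2 s s w"
  shows "agree_A (rev w) (rev (p @ z # q @ z # t # r))"
proof -
  define w' where "w' = p @ z # q @ z # t # r"
  have "sub2 y x w \<longleftrightarrow> sub2 y x w'" for y x
    using z by (auto simp: w w'_def)
  moreover have "sub3 x y v w \<longleftrightarrow> sub3 x y v w'" if x: "\<not> sub2 x x w" for x y v
  proof -
    have "x \<notin> set (z # q)"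
      using q x by auto
    then show ?thesis
      using z sub2_set[of x y p] sub2_set[of x y r] unfolding w w'_def by (simp; blast)
  qed
  moreover have "set w = set w'"
    by (auto simp: w w'_def)
  ultimately have "agree_A (rev w) (rev w')"
    by (simp add: agree_A_def agree2_def)
  then show ?thesis
    by (simp only: w'_def)
qed

text \<open>Equivalent words have the same content, so their numbers of triples are bounded. An
  insertion keeps the word equivalent and loses no triple; at a word with the most triples it
  therefore gains none.\<close>

lemma ex_saturated:
  obtains w where "agree_A (rev u) (rev w)" "saturated w"
proof -
  define T where "T w = {(x, y, z). sub3 x y z w}" for w :: word
  have T_sub: "T w \<subseteq> set w \<times> set w \<times> set w" for w
    by (auto simp: T_def dest!: sub3_imp2 sub2_set)
  then have T_fin: "finite (T w)" for w
    by (rule finite_subset) simp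
  have "card (T w) < Suc (card (set u \<times> set u \<times> set u))" if "agree_A (rev u) (rev w)" for w
  proof -
    have "set u = set w"
      using that by (simp add: agree_A_def agree2_def)
    then show ?thesis
      using card_mono[OF _ T_sub[of w]] by (simp add: less_Suc_eq_le)
  qed
  moreover have "agree_A (rev u) (rev u)"
    by (simp add: agree_A_def agree2_def)
  ultimately obtain w where w: "agree_A (rev u) (rev w)"
    and max: "\<And>v. agree_A (rev u) (rev v) \<Longrightarrow> card (T v) \<le> card (T w)"
    using ex_has_greatest_nat[of "\<lambda>w. agree_A (rev u) (rev w)" u "\<lambda>w. card (T w)"] by blast
  have "saturated w"
    unfolding saturated_def
  proof (intro allI impI)
    fix p z q t r y
    assume eq: "w = p @ z # q @ t # r" and t: "\<not> sub2 t t w"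
      and q: "\<forall>s\<in>set (z # q). sub2 s s w" and z: "z \<in> set r" and y: "y \<in> set (p @ z # q)"
    let ?w = "p @ z # q @ z # t # r"
    have "agree_A (rev u) (rev ?w)"
      using w agree_A_rev_insert[OF eq z q] by (auto simp: agree_A_def agree2_def)
    then have "card (T ?w) \<le> card (T w)"
      by (rule max)
    moreover have "T w \<subseteq> T ?w"
      by (auto simp: T_def eq)
    ultimately have "T w = T ?w"
      using T_fin by (simp add: card_seteq)
    moreover have "(y, z, t) \<in> T ?w"
      using y by (auto simp: T_def)
    ultimately have "(y, z, t) \<in> T w"
      by blast
    then show "sub3 y z t w"
      by (simp add: T_def)
  qed
  then show ?thesis
    using that w by blast
qed

text \<open>Suppose v lacks \<open>yzx\<close>, and let t be the first simple letter after the last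
  z before x in v. Saturation forces y to stay out of the part of v before t. By agreement on pairs,
  all of y comes after t in u as well, so u contains \<open>tzx\<close>. Both t and x are simple, so
  v contains \<open>tzx\<close> too; but in v no z stands between t and x.\<close>

lemma saturated_sub3:
  assumes agree2: "agree2 u v" and agree_Q: "agree_Q u v" and sat: "saturated v"
    and x: "\<not> sub2 x x u" and yzx: "sub3 y z x u"
  shows "sub3 y z x v"
proof (rule ccontr)
  assume no: "\<not> sub3 y z x v"
  have set: "set u = set v" and two: "\<And>a b. sub2 a b u \<longleftrightarrow> sub2 a b v"
    using agree2 by (auto simp: agree2_def)
  have three: "sub3 a b c v" if "sub3 a b c u" "\<not> sub2 a a v" "\<not> sub2 c c v" for a b c
    using agree_Q that by (simp add: agree_Q_def)
  have v2: "sub2 y z v" "sub2 y x v" "sub2 z x v" and xv: "\<not> sub2 x x v"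
    using sub3_imp2[OF yzx] x two by auto
  have "x \<in> set v"
    using v2 by (auto dest: sub2_set)
  then obtain P r' where v: "v = P @ x # r'" and xP: "x \<notin> set P" "x \<notin> set r'"
    using xv by (rule simple_split)
  have "z \<noteq> x" "y \<noteq> x"
    using v2 xv by auto
  have zP: "z \<in> set P" and yP: "y \<in> set P"
    using v2 v xP by (auto dest: sub2_set)
  obtain p P2 where P: "P = p @ z # P2" and zP2: "z \<notin> set P2"
    using split_list_last[OF zP] by blast
  have yp: "y \<notin> set p"
    using no v P by auto
  have y_multiple: "sub2 y y v"
  proof (rule ccontr)
    assume "\<not> sub2 y y v"
    then show False
      using three[OF yzx] xv no by blast
  qed
  have z_multiple: "sub2 z z v"
  proof (rule ccontr)
    assume zz: "\<not> sub2 z z v"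
    then have "y \<noteq> z"
      using v2 by auto
    moreover have "z \<notin> set p" "z \<notin> set r'"
      using zz v P by auto
    ultimately show False
      using v2(1) v P zP2 yp \<open>z \<noteq> x\<close> by (auto dest: sub2_set)
  qed
  \<comment> \<open>Appending x guarantees that a simple letter exists. At this point t may still be
    x.\<close>
  obtain q t r0 where q: "P2 @ [x] = q @ t # r0" and t: "\<not> sub2 t t v"
    and q_multiple: "\<forall>s\<in>set q. sub2 s s v"
    using split_list_first_prop[of "P2 @ [x]" "\<lambda>s. \<not> sub2 s s v"] xv by auto
  have v_eq: "v = p @ z # q @ t # (r0 @ r')"
    using v P q by (metis append.assoc append_Cons append_Nil)
  have x_in: "x \<in> set (t # r0)"
  proof -
    have "last (q @ t # r0) = x"
      using q by (metis last_snoc)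
    then show ?thesis
      by (metis last_appendR last_in_set list.distinct(1))
  qed
  have zt: "z \<noteq> t"
    using t z_multiple by blast
  have z_q: "z \<notin> set q" "z \<notin> set r0"
  proof -
    have "z \<notin> set (P2 @ [x])"
      using zP2 \<open>z \<noteq> x\<close> by simp
    then show "z \<notin> set q" "z \<notin> set r0"
      unfolding q by auto
  qed
  have t_once: "t \<notin> set p" "t \<notin> set q" "t \<notin> set r0" "t \<notin> set r'"
    using t unfolding v_eq by auto
  \<comment> \<open>If y were in the block, the pair \<open>yz\<close> of v would need a z after t.
    Saturation would then give \<open>yzt\<close>, and with x not before t also
    \<open>yzx\<close>.\<close>
  have y_zq: "y \<notin> set (z # q)"
  proof
    assume y: "y \<in> set (z # q)"
    have "z \<in> set (r0 @ r')"
    proof (rule ccontr)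
      assume z: "z \<notin> set (r0 @ r')"
      have "sub2 y z (p @ z # q @ t # (r0 @ r'))"
        using v2(1) v_eq by simp
      then show False
        using z z_q zt yp by (auto dest: sub2_set)
    qed
    then have "sub3 y z t v"
      using sat[unfolded saturated_def, rule_format, OF v_eq t] q_multiple z_multiple y by auto
    then have "sub2 y z (p @ z # q)"
      using t_once zt unfolding v_eq by (auto dest: sub2_set sub3_imp2)
    then have "sub3 y z x ((p @ z # q) @ (t # r0) @ r')"
      using x_in by auto
    then show False
      using no v_eq by simp
  qed
  have "y \<noteq> t"
    using t y_multiple by blast
  have "\<not> sub2 y t v"
    using yp y_zq t_once \<open>y \<noteq> t\<close> unfolding v_eq by (auto dest: sub2_set)
  then have yt: "\<not> sub2 y t u"
    using two by blast
  have "t \<in> set u"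
    using set v_eq by auto
  moreover have "\<not> sub2 t t u"
    using t two by blast
  ultimately obtain u1 u2 where u: "u = u1 @ t # u2" "t \<notin> set u1" "t \<notin> set u2"
    by (rule simple_split)
  have "y \<notin> set u1"
    using yt u by auto
  \<comment> \<open>In u every y comes after t, so the whole triple lies after t, and t can replace
    y as its first letter.\<close>
  then have "sub3 y z x u2"
    using yzx u \<open>y \<noteq> t\<close> sub3_imp2[of y z x u1] by (auto dest: sub2_set)
  then have "sub3 t z x u"
    using u by (auto dest: sub3_imp2)
  then have tzx: "sub3 t z x v"
    using three t xv by blast
  have "t \<noteq> x"
  proof
    assume "t = x"
    then have "sub2 x z u" "sub2 z x u"
      using sub3_imp2[OF \<open>sub3 t z x u\<close>] sub3_imp2[OF yzx] by auto
    then show False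
      using sub3_imp2[OF \<open>sub3 t z x u\<close>] \<open>t = x\<close> x by blast
  qed
  then have "x \<in> set r0"
    using x_in by simp
  then have "sub3 t z x (r0 @ r') \<or> sub2 z x (r0 @ r')"
    using tzx t_once xv zt unfolding v_eq by (auto dest: sub2_set sub3_imp2)
  then have "sub2 z x (r0 @ r')"
    using sub3_imp2[of t z x "r0 @ r'"] by blast
  then show False
    using z_q xP \<open>x \<in> set r0\<close> by (auto dest: sub2_set)
qed

lemma saturated_agree_A:
  assumes "agree2 u v" "agree_Q u v" "saturated u" "saturated v"
  shows "agree_A u v"
proof -
  have "agree2 v u" "agree_Q v u"
    using assms(1,2) by (auto simp: agree2_def agree_Q_def)
  moreover have "sub2 x x u \<longleftrightarrow> sub2 x x v" for x
    using assms(1) by (simp add: agree2_def)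
  ultimately show ?thesis
    using assms saturated_sub3[of u v] saturated_sub3[of v u] unfolding agree_A_def by blast
qed

text \<open>Deduce u = u' = v' = v with saturated words u' and v': the outer steps are identities of
  the dual of A, the middle one is an identity of A.\<close>

lemma meet_A_dual_A:
  "variety_meet (models (ids act_A {Gen_e, Gen_f, Gen_c}))
     (models (rev_ids (ids act_A {Gen_e, Gen_f, Gen_c})) :: 'x monoid set) \<subseteq>
   models (ids act_A {Gen_e, Gen_f} \<inter> ids act_Q {Gen_e, Gen_b, Gen_c})"
proof
  let ?A = "ids act_A {Gen_e, Gen_f, Gen_c}"
  fix G :: "'x monoid"
  assume "G \<in> variety_meet (models ?A) (models (rev_ids ?A))"
  then have G: "monoid G" "\<And>p. p \<in> ?A \<Longrightarrow> satisfies G p" "\<And>p. p \<in> rev_ids ?A \<Longrightarrow> satisfies G p"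
    by (auto simp: variety_meet_def models_def)
  have trans: "satisfies G (u, w)" if "satisfies G (u, v)" "satisfies G (v, w)" for u v w
    using that by (simp add: satisfies_def)
  have "satisfies G (u, v)"
    if "(u, v) \<in> ids act_A {Gen_e, Gen_f}" "(u, v) \<in> ids act_Q {Gen_e, Gen_b, Gen_c}" for u v
  proof -
    have uv: "agree2 u v" "agree_Q u v"
      using that ids_A0_imp_agree2 ids_Q_imp_agree_Q by auto
    obtain u' where u': "agree_A (rev u) (rev u')" "saturated u'"
      by (rule ex_saturated)
    obtain v' where v': "agree_A (rev v) (rev v')" "saturated v'"
      by (rule ex_saturated)
    \<comment> \<open>Saturating preserves \<open>agree_Q\<close>, because that condition is
      invariant under reversal and necessary for identities of A.\<close>
    have Q: "agree_Q u u'" "agree_Q v v'"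
      using ids_A_imp_agree_Q[OF agree_A_imp_ids] u' v' agree_Q_rev by blast+
    have two: "agree2 u u'" "agree2 v v'"
      using u' v' by (simp_all add: agree_A_def agree2_rev)
    have "agree2 u' v'" "agree_Q u' v'"
      using uv two Q by (simp_all add: agree2_def agree_Q_def)
    then have "agree_A u' v'"
      using u' v' by (intro saturated_agree_A)
    then have "satisfies G (u', v')"
      by (intro G agree_A_imp_ids)
    moreover have "satisfies G (u, u')" "satisfies G (v', v)"
      using u' v' by (auto intro!: G(3) agree_A_imp_ids agree_A_sym)
    ultimately show ?thesis
      using trans by blast
  qed
  then show "G \<in> models (ids act_A {Gen_e, Gen_f} \<inter> ids act_Q {Gen_e, Gen_b, Gen_c})"
    using G(1) by (auto simp: models_def)
qed

section \<open>The monoids over \<open>\<gamma>\<close>\<close>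

lemma remdups_adj_idem [simp]: "remdups_adj (remdups_adj w) = remdups_adj w"
  using distinct_adj_remdups_adj distinct_adj_altdef by blast

lemma remdups_adj_append_cong:
  assumes "remdups_adj u = remdups_adj u'" "remdups_adj v = remdups_adj v'"
  shows "remdups_adj (u @ v) = remdups_adj (u' @ v')"
proof -
  have right: "remdups_adj (u @ v) = remdups_adj (u @ remdups_adj v)" for u v :: "'a list"
    by (induction u) (simp_all add: remdups_adj_Cons)
  have left: "remdups_adj (u @ v) = remdups_adj (remdups_adj u @ v)" for u v :: "'a list"
    using arg_cong[OF right[of "rev v" "rev u"], of rev] by (simp flip: remdups_adj_rev)
  show ?thesis
    using assms right left by metis
qed

lemma remdups_adj_split:
  "x \<notin> set p \<Longrightarrow> x \<notin> set q \<Longrightarrow> remdups_adj (p @ x # q) = remdups_adj p @ x # remdups_adj q"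
proof (induction p rule: remdups_adj.induct)
  case 1
  then show ?case by (cases q) auto
next
  case (2 y)
  then show ?case by (cases q) auto
qed auto

lemma tau1_congruence: "congruence_on UNIV (@) tau1"
  unfolding tau1_def by (rule congruence_generated) auto

text \<open>Collapsing runs of equal letters is a normal form for a = a^2: its kernel is a
  congruence containing the generators, and every word is congruent to its collapsed form.\<close>

lemma tau1_iff: "(u, v) \<in> tau1 \<longleftrightarrow> remdups_adj u = remdups_adj v"
proof
  let ?K = "{(u, v). remdups_adj u = remdups_adj v} :: (word \<times> word) set"
  have "congruence_on UNIV (@) ?K"
    unfolding congruence_on_def equiv_def refl_on_def sym_def trans_def
    by (auto intro: remdups_adj_append_cong)
  then have "tau1 \<subseteq> ?K"
    unfolding tau1_def by (rule generated_congruence_least) auto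
  then show "(u, v) \<in> tau1 \<Longrightarrow> remdups_adj u = remdups_adj v" by auto
next
  have equiv: "equiv UNIV tau1"
    using tau1_congruence by (simp add: congruence_on_def)
  have refl: "(w, w) \<in> tau1" for w
    using equiv by (simp add: equiv_def refl_on_def)
  have sym: "(w, v) \<in> tau1" if "(v, w) \<in> tau1" for v w
    using equiv that by (auto simp: equiv_def elim: symE)
  have trans: "(u, w) \<in> tau1" if "(u, v) \<in> tau1" "(v, w) \<in> tau1" for u v w
    using equiv that by (auto simp: equiv_def elim: transE)
  have app: "(u @ v, u' @ v') \<in> tau1" if "(u, u') \<in> tau1" "(v, v') \<in> tau1" for u v u' v'
    using that tau1_congruence by (simp add: congruence_on_def)
  have gen: "([x], [x, x]) \<in> tau1" for x
    unfolding tau1_def by (rule subsetD[OF generators_in_congruence]) simp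
  have reduce: "(w, remdups_adj w) \<in> tau1" for w
  proof (induction w rule: remdups_adj.induct)
    case (3 x y w)
    show ?case
    proof (cases "x = y")
      case True
      have "(x # x # w, x # w) \<in> tau1"
        using app[OF sym[OF gen[of x]] refl[of w]] by simp
      then show ?thesis
        using True 3 trans by auto
    next
      case False
      then show ?thesis
        using app[OF refl[of "[x]"] 3(2)] by simp
    qed
  qed (simp_all add: refl)
  assume eq: "remdups_adj u = remdups_adj v"
  show "(u, v) \<in> tau1"
    using reduce[of u] unfolding eq by (rule trans) (rule sym[OF reduce])
qed

lemma mul_iff: "x \<in> mul w \<longleftrightarrow> sub2 x x w"
proof -
  have "sub2 x x w \<longleftrightarrow> 2 \<le> count_list w x"
  proof (induction w)
    case (Cons a w)
    have "x \<in> set w \<longleftrightarrow> 1 \<le> count_list w x"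
      using count_list_0_iff[of w x] by linarith
    then show ?case
      using Cons by auto
  qed simp
  then show ?thesis
    by (simp add: mul_def)
qed

lemma gamma_iff:
  "(u, v) \<in> gamma \<longleftrightarrow> remdups_adj u = remdups_adj v \<and> (\<forall>x. sub2 x x u \<longleftrightarrow> sub2 x x v)"
  by (auto simp: gamma_def tau1_iff mul_iff set_eq_iff)

lemma gamma_set: "(u, v) \<in> gamma \<Longrightarrow> set u = set v"
  unfolding gamma_iff by (metis remdups_adj_set)

lemma gamma_congruence: "congruence_on UNIV (@) gamma"
proof -
  have "equiv UNIV gamma"
    unfolding equiv_def refl_on_def sym_def trans_def by (simp add: gamma_iff)
  moreover have "(u @ v, u' @ v') \<in> gamma" if "(u, u') \<in> gamma" "(v, v') \<in> gamma" for u v u' v'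
    using that gamma_set[OF that(1)] gamma_set[OF that(2)]
      remdups_adj_append_cong[of u u' v v']
    by (simp add: gamma_iff)
  ultimately show ?thesis
    by (simp add: congruence_on_def)
qed

lemma gamma_rev: "(rev u, rev v) \<in> gamma \<longleftrightarrow> (u, v) \<in> gamma"
  by (simp add: gamma_iff)

lemma gamma_sym: "(u, v) \<in> gamma \<Longrightarrow> (v, u) \<in> gamma"
  by (simp add: gamma_iff)

text \<open>Membership of the class of w in the down-closure of \<open>W\<close>, expressed by
  words: the decomposition is only up to \<gamma>.\<close>

definition factor :: "word set \<Rightarrow> word \<Rightarrow> bool" where
  "factor W w \<longleftrightarrow> (\<exists>v\<in>W. \<exists>p s. (v, p @ w @ s) \<in> gamma)"

definition ids_M :: "word set \<Rightarrow> (word \<times> word) set" where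
  "ids_M W = {(u, v). \<forall>\<theta>. factor W (subst \<theta> u) \<or> factor W (subst \<theta> v) \<longrightarrow>
    (subst \<theta> u, subst \<theta> v) \<in> gamma}"

lemma ids_M_pair: "ids_M {v, w} = ids_M {v} \<inter> ids_M {w}"
  unfolding ids_M_def factor_def by blast

lemma factor_rev: "factor (rev ` W) w \<longleftrightarrow> factor W (rev w)"
proof
  assume "factor (rev ` W) w"
  then obtain v p s where "v \<in> W" "(rev v, p @ w @ s) \<in> gamma"
    unfolding factor_def by auto
  then have "(v, rev s @ rev w @ rev p) \<in> gamma"
    using gamma_rev[of "rev v" "p @ w @ s"] by simp
  then show "factor W (rev w)"
    using \<open>v \<in> W\<close> unfolding factor_def by blast
next
  assume "factor W (rev w)"
  then obtain v p s where "v \<in> W" "(v, p @ rev w @ s) \<in> gamma"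
    unfolding factor_def by auto
  then have "(rev v, rev s @ w @ rev p) \<in> gamma"
    using gamma_rev[of v "p @ rev w @ s"] by simp
  then show "factor (rev ` W) w"
    using \<open>v \<in> W\<close> unfolding factor_def by blast
qed

lemma ids_M_rev: "ids_M (rev ` W) = rev_ids (ids_M W)"
proof -
  have "(u, v) \<in> ids_M (rev ` W) \<longleftrightarrow> (\<forall>\<theta>. factor W (rev (subst \<theta> u)) \<or> factor W (rev (subst \<theta> v)) \<longrightarrow>
      (rev (subst \<theta> u), rev (subst \<theta> v)) \<in> gamma)" for u v
    by (simp add: ids_M_def factor_rev gamma_rev del: rev_concat)
  also have "\<dots> u v \<longleftrightarrow> (\<forall>\<theta>. factor W (subst (\<lambda>x. rev (\<theta> x)) (rev u)) \<or>
      factor W (subst (\<lambda>x. rev (\<theta> x)) (rev v)) \<longrightarrow>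
      (subst (\<lambda>x. rev (\<theta> x)) (rev u), subst (\<lambda>x. rev (\<theta> x)) (rev v)) \<in> gamma)" for u v
    by (simp only: rev_subst)
  also have "\<dots> u v \<longleftrightarrow> (rev u, rev v) \<in> ids_M W" for u v
  proof
    assume *: "\<forall>\<theta>. factor W (subst (\<lambda>x. rev (\<theta> x)) (rev u)) \<or>
      factor W (subst (\<lambda>x. rev (\<theta> x)) (rev v)) \<longrightarrow>
      (subst (\<lambda>x. rev (\<theta> x)) (rev u), subst (\<lambda>x. rev (\<theta> x)) (rev v)) \<in> gamma"
    show "(rev u, rev v) \<in> ids_M W"
      unfolding ids_M_def
    proof clarify
      fix \<theta> :: "letter \<Rightarrow> word"
      assume "factor W (subst \<theta> (rev u)) \<or> factor W (subst \<theta> (rev v))"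
      then show "(subst \<theta> (rev u), subst \<theta> (rev v)) \<in> gamma"
        using spec[OF *, of "\<lambda>x. rev (\<theta> x)"] by simp
    qed
  qed (simp add: ids_M_def)
  finally show ?thesis
    by auto
qed

lemma gamma_class_mult:
  "class_mult (@) gamma (gamma `` {u}) (gamma `` {v}) = gamma `` {u @ v}"
proof -
  have equiv: "equiv UNIV gamma"
    using gamma_congruence by (simp add: congruence_on_def)
  have "gamma `` {x @ y} = gamma `` {u @ v}" if "x \<in> gamma `` {u}" "y \<in> gamma `` {v}" for x y
  proof -
    have "(u @ v, x @ y) \<in> gamma"
      using that gamma_congruence by (simp add: congruence_on_def)
    then show ?thesis
      using equiv_class_eq[OF equiv] by blast
  qed
  moreover have "u \<in> gamma `` {u}" "v \<in> gamma `` {v}"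
    by (simp_all add: gamma_iff)
  ultimately show ?thesis
    unfolding class_mult_def by blast
qed

lemma gamma_class_eq_iff: "gamma `` {u} = gamma `` {v} \<longleftrightarrow> (u, v) \<in> gamma"
  using gamma_congruence eq_equiv_class_iff[of UNIV gamma u v] by (simp add: congruence_on_def)

lemma down_closure_iff:
  "gamma `` {w} \<in> down_closure gamma ((\<lambda>v. gamma `` {v}) ` W) \<longleftrightarrow> factor W w"
proof -
  have "(w, w) \<in> gamma"
    by (simp add: gamma_iff)
  then show ?thesis
    by (auto simp: down_closure_def class_le_def quotient_def gamma_class_mult gamma_class_eq_iff factor_def)
qed

text \<open>Two nonfactors both become zero. Being a factor is invariant under \<gamma>, so
  otherwise equality in the quotient is equality of classes.\<close>

lemma rees_embed_eq_iff:
  fixes W defines "r \<equiv> rees_embed gamma ((\<lambda>v. gamma `` {v}) ` W)"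
  shows "r (gamma `` {u}) = r (gamma `` {v}) \<longleftrightarrow> (factor W u \<or> factor W v \<longrightarrow> (u, v) \<in> gamma)"
proof -
  have "factor W v" if uv: "(u, v) \<in> gamma" and u: "factor W u" for u v
  proof -
    have "gamma `` {u} = gamma `` {v}"
      using uv by (simp add: gamma_class_eq_iff)
    then show ?thesis
      using u by (simp flip: down_closure_iff)
  qed
  then show ?thesis
    using gamma_sym[of u v] by (auto simp: r_def rees_embed_def down_closure_iff gamma_class_eq_iff)
qed

lemma eval_M_monoid:
  fixes W defines "C \<equiv> (\<lambda>v. gamma `` {v}) ` W"
  shows "eval (M_monoid gamma C) (\<lambda>x. rees_embed gamma C (gamma `` {\<theta> x})) w =
    rees_embed gamma C (gamma `` {subst \<theta> w})"
proof (induction w)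
  case Nil
  then show ?case by (simp add: M_monoid_def)
next
  case (Cons x w)
  \<comment> \<open>Nonfactors form an ideal: once a partial product is zero, the whole word is no
    factor and both sides are zero.\<close>
  have factors: "factor W u \<and> factor W v" if uv: "factor W (u @ v)" for u v
  proof -
    obtain y p s where "y \<in> W" "(y, p @ (u @ v) @ s) \<in> gamma"
      using uv unfolding factor_def by blast
    then have "(y, p @ u @ (v @ s)) \<in> gamma" "(y, (p @ u) @ v @ s) \<in> gamma"
      by simp_all
    then show ?thesis
      using \<open>y \<in> W\<close> unfolding factor_def by blast
  qed
  show ?case
    using Cons factors[of "\<theta> x" "subst \<theta> w"]
    by (auto simp: M_monoid_def rees_embed_def C_def down_closure_iff gamma_class_mult split: option.splits)
qed

lemma satisfies_M_monoid:
  assumes "finite W"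
  shows "satisfies (M_monoid gamma ((\<lambda>v. gamma `` {v}) ` W)) (u, v) \<longleftrightarrow> (u, v) \<in> ids_M W"
proof -
  define C where "C = (\<lambda>v. gamma `` {v}) ` W"
  let ?r = "\<lambda>w. rees_embed gamma C (gamma `` {w})"
  have eval: "eval (M_monoid gamma C) (\<lambda>x. ?r (\<theta> x)) w = ?r (subst \<theta> w)" for \<theta> w
    unfolding C_def by (rule eval_M_monoid)
  have eq: "?r u = ?r v \<longleftrightarrow> (factor W u \<or> factor W v \<longrightarrow> (u, v) \<in> gamma)" for u v
    unfolding C_def by (rule rees_embed_eq_iff)
  \<comment> \<open>A letter foreign to all words of \<open>W\<close> yields a word representing
    zero, so that every element of the carrier is the value of a word.\<close>
  have "finite (\<Union>w\<in>W. set w)"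
    using assms by simp
  then obtain c where c: "c \<notin> (\<Union>w\<in>W. set w)"
    using ex_new_if_finite[OF infinite_UNIV_nat] by blast
  have c_factor: "\<not> factor W [c]"
  proof
    assume "factor W [c]"
    then obtain w p s where "w \<in> W" "(w, p @ [c] @ s) \<in> gamma"
      unfolding factor_def by blast
    then show False
      using c gamma_set[of w "p @ [c] @ s"] by auto
  qed
  have carrier: "\<exists>w. x = ?r w" if "x \<in> carrier (M_monoid gamma C)" for x
  proof (cases x)
    case None
    then show ?thesis
      using c_factor by (intro exI[of _ "[c]"]) (simp add: rees_embed_def C_def down_closure_iff)
  next
    case (Some d)
    then have d: "d \<in> down_closure gamma C"
      using that by (auto simp: M_monoid_def)
    then obtain w where "d = gamma `` {w}"
      by (auto simp: down_closure_def elim: quotientE)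
    then show ?thesis
      using Some d by (intro exI[of _ w]) (simp add: rees_embed_def)
  qed
  have in_carrier: "?r w \<in> carrier (M_monoid gamma C)" for w
    by (simp add: rees_embed_def M_monoid_def)
  have "satisfies (M_monoid gamma C) (u, v) \<longleftrightarrow> (u, v) \<in> ids_M W"
  proof
    assume sat: "satisfies (M_monoid gamma C) (u, v)"
    show "(u, v) \<in> ids_M W"
      unfolding ids_M_def
    proof (intro CollectI case_prodI allI)
      fix \<theta>
      from sat[unfolded satisfies_def, rule_format, OF in_carrier]
      show "factor W (subst \<theta> u) \<or> factor W (subst \<theta> v) \<longrightarrow> (subst \<theta> u, subst \<theta> v) \<in> gamma"
        unfolding eval eq[symmetric] by simp
    qed
  next
    assume uv: "(u, v) \<in> ids_M W"
    show "satisfies (M_monoid gamma C) (u, v)"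
      unfolding satisfies_def
    proof (intro allI impI)
      fix \<phi> :: "letter \<Rightarrow> _"
      assume "\<forall>x. \<phi> x \<in> carrier (M_monoid gamma C)"
      then have "\<forall>x. \<exists>w. \<phi> x = ?r w"
        using carrier by blast
      then obtain \<theta> where "\<forall>x. \<phi> x = ?r (\<theta> x)"
        by (rule choice[THEN exE])
      then have \<phi>: "\<phi> = (\<lambda>x. ?r (\<theta> x))"
        by auto
      have "?r (subst \<theta> u) = ?r (subst \<theta> v)"
        using uv by (simp add: eq ids_M_def)
      then show "eval (M_monoid gamma C) \<phi> (fst (u, v)) = eval (M_monoid gamma C) \<phi> (snd (u, v))"
        unfolding \<phi> by (simp add: eval)
    qed
  qed
  then show ?thesis
    by (simp add: C_def)
qed

lemma var_M_eq:
  assumes "finite W"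
  shows "(var_M gamma ((\<lambda>v. gamma `` {v}) ` W) :: 'x monoid set) = models (ids_M W)"
proof -
  have "{p. satisfies (M_monoid gamma ((\<lambda>v. gamma `` {v}) ` W)) p} = ids_M W"
    using satisfies_M_monoid[OF assms] by auto
  then show ?thesis
    by (simp add: var_M_def variety_generated_by_eq)
qed

section \<open>The symbols of the quotient as \<gamma>-classes of words\<close>

lemma once_eq: "once a = gamma `` {[a]}"
proof -
  have "w = [a]" if "([a], w) \<in> gamma" for w
  proof -
    have "remdups_adj w = [a]" "\<not> sub2 a a w"
      using that by (auto simp: gamma_iff)
    then have w: "w = replicate (length w) a" "w \<noteq> []"
      by (auto dest: remdups_adj_singleton)
    then obtain n where n: "length w = Suc n"
      by (cases w) auto
    have "n = 0"
    proof (rule ccontr)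
      assume "n \<noteq> 0"
      then have "a \<in> set (replicate n a)" by simp
      then show False
        using w n \<open>\<not> sub2 a a w\<close> by (metis replicate_Suc sub2.simps(2))
    qed
    then show ?thesis
      using w n by simp
  qed
  then show ?thesis
    by (auto simp: once_def gamma_iff)
qed

lemma sub2_replicate [simp]: "sub2 y z (replicate n a) \<longleftrightarrow> y = a \<and> z = a \<and> 2 \<le> n"
  by (induction n) auto

lemma mplus_eq: "mplus a = gamma `` {[a, a]}"
proof -
  have "w \<in> mplus a" if "([a, a], w) \<in> gamma" for w
  proof -
    have "remdups_adj w = [a]" "sub2 a a w"
      using that by (auto simp: gamma_iff)
    then have w: "w = replicate (length w) a"
      by (auto dest: remdups_adj_singleton)
    then have "2 \<le> length w"
      using \<open>sub2 a a w\<close> sub2_replicate[of a a "length w" a] by simp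
    then show ?thesis
      using w unfolding mplus_def by blast
  qed
  moreover have "([a, a], replicate n a) \<in> gamma" if "2 \<le> n" for n
    using that by (auto simp: gamma_iff remdups_adj_replicate)
  ultimately show ?thesis
    by (auto simp: mplus_def)
qed

text \<open>Closure of \<open>E\<close> under substitution reduces the claim to the factors
  themselves: each has to be an isoterm for \<open>E\<close> up to \<gamma>.\<close>

lemma ids_subset_ids_M:
  assumes subst: "\<And>u v \<theta>. (u, v) \<in> E \<Longrightarrow> (subst \<theta> u, subst \<theta> v) \<in> E"
    and sym: "\<And>u v. (u, v) \<in> E \<Longrightarrow> (v, u) \<in> E"
    and isoterm: "\<And>w w'. factor W w \<Longrightarrow> (w, w') \<in> E \<Longrightarrow> (w, w') \<in> gamma"
  shows "E \<subseteq> ids_M W"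
proof (rule subrelI)
  fix u v assume uv: "(u, v) \<in> E"
  have "(subst \<theta> u, subst \<theta> v) \<in> gamma" if "factor W (subst \<theta> u) \<or> factor W (subst \<theta> v)" for \<theta>
    using that isoterm[OF _ subst[OF uv]] isoterm[OF _ sym[OF subst[OF uv]]] gamma_sym by blast
  then show "(u, v) \<in> ids_M W"
    by (simp add: ids_M_def)
qed

lemma rev_ids_subst:
  "(u, v) \<in> rev_ids (ids \<tau> X) \<Longrightarrow> (subst \<theta> u, subst \<theta> v) \<in> rev_ids (ids \<tau> X)"
  using ids_subst[of "rev u" "rev v" \<tau> X "\<lambda>x. rev (\<theta> x)"]
  by (simp only: rev_ids_iff rev_subst)

text \<open>Only multiple letters can form runs, so only they have to act idempotently.\<close>

lemma act_remdups_adj: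
  "(\<And>x. sub2 x x w \<Longrightarrow> \<kappa> x O \<kappa> x = \<kappa> x) \<Longrightarrow> act \<kappa> (remdups_adj w) = act \<kappa> w"
proof (induction w rule: remdups_adj.induct)
  case (3 x y w)
  show ?case
  proof (cases "x = y")
    case True
    have "act \<kappa> (remdups_adj (x # w)) = act \<kappa> (x # w)"
      using 3(1) 3(3) True by simp
    moreover have "\<kappa> x O \<kappa> x = \<kappa> x"
      using 3(3)[of x] True by simp
    ultimately show ?thesis
      using True by (simp flip: O_assoc)
  next
    case False
    then show ?thesis
      using 3 by simp
  qed
qed simp_all

lemma act_gamma:
  assumes "(v, w) \<in> gamma" "\<And>x. sub2 x x v \<Longrightarrow> \<kappa> x O \<kappa> x = \<kappa> x"
  shows "act \<kappa> v = act \<kappa> w"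
  using assms act_remdups_adj[of v \<kappa>] act_remdups_adj[of w \<kappa>] by (simp add: gamma_iff)

text \<open>The empty relation is absorbing, so every factor of a word labelling a path labels a
  path as well. This bounds the shape of factors defined only up to \<gamma>.\<close>

lemma act_factor:
  assumes "factor {v} w" "act \<kappa> v \<noteq> {}" "\<And>x. sub2 x x v \<Longrightarrow> \<kappa> x O \<kappa> x = \<kappa> x"
  shows "act \<kappa> w \<noteq> {}"
proof -
  obtain p s where "(v, p @ w @ s) \<in> gamma"
    using assms(1) by (auto simp: factor_def)
  then have "act \<kappa> (p @ w @ s) \<noteq> {}"
    using act_gamma[of v "p @ w @ s" \<kappa>] assms by simp
  then show ?thesis
    by auto
qed

lemma factor_set: "factor {v} w \<Longrightarrow> set w \<subseteq> set v"
  using gamma_set by (fastforce simp: factor_def)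

text \<open>Here \<psi> embeds the semigroup into the quotient and \<kappa> reads the action back.
  If one side acts nontrivially, its image is a factor, so the two images are \<gamma>-equivalent;
  \<kappa> respects this because it is idempotent on the multiple letters of v.\<close>

lemma ids_M_subset_ids:
  assumes \<psi>: "\<And>g. g \<in> X \<Longrightarrow> act \<kappa> (\<psi> g) = \<tau> g"
    and idem: "\<And>x. sub2 x x v \<Longrightarrow> \<kappa> x O \<kappa> x = \<kappa> x"
    and factor: "\<And>p. p \<in> lists X \<Longrightarrow> act \<tau> p \<noteq> {} \<Longrightarrow> factor {v} (concat (map \<psi> p))"
  shows "ids_M {v} \<subseteq> ids \<tau> X"
proof (rule subrelI)
  fix u w assume uw: "(u, w) \<in> ids_M {v}"
  have act_\<psi>: "act \<kappa> (concat (map \<psi> p)) = act \<tau> p" if "p \<in> lists X" for p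
    using that by (induction p rule: list.induct) (simp_all add: \<psi>)
  show "(u, w) \<in> ids \<tau> X"
    unfolding ids_def
  proof (intro CollectI case_prodI allI impI)
    fix \<theta> :: "letter \<Rightarrow> _" assume \<theta>: "\<forall>x. \<theta> x \<in> lists X"
    let ?\<eta> = "\<lambda>x. concat (map \<psi> (\<theta> x))"
    have \<eta>: "subst ?\<eta> p = concat (map \<psi> (subst \<theta> p))" for p
      by (induction p) simp_all
    have in_lists: "subst \<theta> p \<in> lists X" for p
      using \<theta> by (intro subst_in_lists) simp
    have eq: "act \<tau> (subst \<theta> p) = act \<tau> (subst \<theta> q)"
      if "act \<tau> (subst \<theta> p) \<noteq> {}" "factor {v} (subst ?\<eta> p) \<Longrightarrow> (subst ?\<eta> p, subst ?\<eta> q) \<in> gamma" for p q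
    proof -
      have f: "factor {v} (subst ?\<eta> p)"
        unfolding \<eta> using that(1) in_lists by (rule factor[rotated])
      then obtain r s where rs: "(v, r @ subst ?\<eta> p @ s) \<in> gamma"
        by (auto simp: factor_def)
      have "\<kappa> x O \<kappa> x = \<kappa> x" if "sub2 x x (subst ?\<eta> p)" for x
      proof (rule idem)
        have "sub2 x x (r @ subst ?\<eta> p @ s)"
          using that by (simp only: sub2_append) simp
        then show "sub2 x x v"
          using rs by (simp only: gamma_iff)
      qed
      then have "act \<kappa> (subst ?\<eta> p) = act \<kappa> (subst ?\<eta> q)"
        using act_gamma that(2)[OF f] by blast
      then show ?thesis
        unfolding \<eta> using act_\<psi> in_lists by simp
    qed
    have g: "factor {v} (subst ?\<eta> u) \<or> factor {v} (subst ?\<eta> w) \<longrightarrow> (subst ?\<eta> u, subst ?\<eta> w) \<in> gamma"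
      using uw unfolding ids_M_def by blast
    show "act \<tau> (subst \<theta> u) = act \<tau> (subst \<theta> w)"
    proof (cases "act \<tau> (subst \<theta> u) = {}")
      case True
      have "act \<tau> (subst \<theta> w) = {}"
      proof (rule ccontr)
        assume "act \<tau> (subst \<theta> w) \<noteq> {}"
        from eq[OF this, of u] show False
          using True g gamma_sym \<open>act \<tau> (subst \<theta> w) \<noteq> {}\<close> by blast
      qed
      then show ?thesis
        using True by simp
    next
      case False
      from eq[OF False, of w] show ?thesis
        using g by blast
    qed
  qed
qed

section \<open>Factors of the defining words\<close>

text \<open>From S2 only a can be read; from S1 only b, until t leads to S2; from S0 only a, until b
  or t. The letters have an arbitrary type since the lemma is applied both to words of the monoid
  and to words in generators.\<close>

lemma shape_A:
  fixes \<kappa> :: "'a \<Rightarrow> state rel"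
  assumes \<kappa>: "\<kappa> a = {(S0, S0), (S2, S2)}" "\<kappa> b = {(S0, S1), (S1, S1)}" "\<kappa> t = {(S0, S2), (S1, S2)}"
      "\<And>x. x \<notin> {a, b, t} \<Longrightarrow> \<kappa> x = {}"
    and w: "act \<kappa> w \<noteq> {}"
  shows "\<exists>i j k. w = replicate i a @ replicate j b \<or> w = replicate i a @ replicate j b @ t # replicate k a"
proof -
  have \<kappa>_in: "x \<in> {a, b, t}" if "(i, j) \<in> \<kappa> x" for i j x
    using \<kappa>(4) that by blast
  have S2: "\<exists>k. w = replicate k a" if "(S2, j) \<in> act \<kappa> w" for j w
    using that
  proof (induction w)
    case (Cons x w)
    then obtain l where l: "(S2, l) \<in> \<kappa> x" "(l, j) \<in> act \<kappa> w" by auto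
    then have "x = a" "l = S2"
      using \<kappa>_in[OF l(1)] l(1) \<kappa>(1-3) by auto
    then show ?case
      using Cons l by (metis replicate_Suc)
  qed simp
  have S1: "\<exists>i k. w = replicate i b \<or> w = replicate i b @ t # replicate k a" if "(S1, j) \<in> act \<kappa> w" for j w
    using that
  proof (induction w)
    case (Cons x w)
    then obtain l where l: "(S1, l) \<in> \<kappa> x" "(l, j) \<in> act \<kappa> w" by auto
    then consider "x = b" "l = S1" | "x = t" "l = S2"
      using \<kappa>_in[OF l(1)] l(1) \<kappa>(1-3) by auto
    then show ?case
    proof cases
      case 1
      then show ?thesis
        using Cons l by (metis append_Cons replicate_Suc)
    next
      case 2
      then show ?thesis
        using S2 l by (metis append_Nil replicate_0)
    qed
  qed simp
  have S0: "\<exists>i j k. w = replicate i a @ replicate j b \<or> w = replicate i a @ replicate j b @ t # replicate k a"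
    if "(S0, j) \<in> act \<kappa> w" for j w
    using that
  proof (induction w)
    case (Cons x w)
    then obtain l where l: "(S0, l) \<in> \<kappa> x" "(l, j) \<in> act \<kappa> w" by auto
    then consider "x = a" "l = S0" | "x = b" "l = S1" | "x = t" "l = S2"
      using \<kappa>_in[OF l(1)] l(1) \<kappa>(1-3) by auto
    then show ?case
    proof cases
      case 1
      then show ?thesis
        using Cons l by (metis append_Cons replicate_Suc)
    next
      case 2
      then show ?thesis
        using S1 l by (metis append_Cons append_Nil replicate_0 replicate_Suc)
    next
      case 3
      then show ?thesis
        using S2 l by (metis append_Nil replicate_0)
    qed
  qed simp
  obtain i j where ij: "(i, j) \<in> act \<kappa> w"
    using w by auto
  then consider "(S0, j) \<in> act \<kappa> w" | "(S1, j) \<in> act \<kappa> w" | "(S2, j) \<in> act \<kappa> w"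
    by (cases i) auto
  then show ?thesis
  proof cases
    case 1
    then show ?thesis by (rule S0)
  next
    case 2
    then show ?thesis using S1 by (metis append_Nil replicate_0)
  next
    case 3
    then show ?thesis using S2 by (metis append_Nil2 replicate_0)
  qed
qed

lemma shape_Q:
  fixes \<kappa> :: "'a \<Rightarrow> state rel"
  assumes \<kappa>: "\<kappa> a = {(S0, S0), (S2, S2)}" "\<kappa> t = {(S0, S1)}" "\<kappa> s = {(S1, S2)}"
      "\<And>x. x \<notin> {a, t, s} \<Longrightarrow> \<kappa> x = {}"
    and w: "act \<kappa> w \<noteq> {}"
  shows "\<exists>i k. w = replicate i a \<or> w = replicate i a @ [t] \<or> w = s # replicate k a \<or>
    w = replicate i a @ t # s # replicate k a"
proof -
  have \<kappa>_in: "x \<in> {a, t, s}" if "(i, j) \<in> \<kappa> x" for i j x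
    using \<kappa>(4) that by blast
  have S2: "\<exists>k. w = replicate k a" if "(S2, j) \<in> act \<kappa> w" for j w
    using that
  proof (induction w)
    case (Cons x w)
    then obtain l where l: "(S2, l) \<in> \<kappa> x" "(l, j) \<in> act \<kappa> w" by auto
    then have "x = a" "l = S2"
      using \<kappa>_in[OF l(1)] l(1) \<kappa>(1-3) by auto
    then show ?case
      using Cons l by (metis replicate_Suc)
  qed simp
  have S1: "w = [] \<or> (\<exists>k. w = s # replicate k a)" if w: "(S1, j) \<in> act \<kappa> w" for j w
  proof (cases w)
    case (Cons x v)
    then obtain l where l: "(S1, l) \<in> \<kappa> x" "(l, j) \<in> act \<kappa> v"
      using w by auto
    then have "x = s" "l = S2"
      using \<kappa>_in[OF l(1)] l(1) \<kappa>(1-3) by auto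
    then show ?thesis
      using Cons l S2 by blast
  qed simp
  have S0: "\<exists>i k. w = replicate i a \<or> w = replicate i a @ [t] \<or>
      w = replicate i a @ t # s # replicate k a" if "(S0, j) \<in> act \<kappa> w" for j w
    using that
  proof (induction w)
    case (Cons x w)
    then obtain l where l: "(S0, l) \<in> \<kappa> x" "(l, j) \<in> act \<kappa> w" by auto
    then consider "x = a" "l = S0" | "x = t" "l = S1"
      using \<kappa>_in[OF l(1)] l(1) \<kappa>(1-3) by auto
    then show ?case
    proof cases
      case 1
      then show ?thesis
        using Cons l by (metis append_Cons replicate_Suc)
    next
      case 2
      then show ?thesis
        using S1[of j w] l by (metis append_Nil replicate_0)
    qed
  qed simp
  obtain i j where ij: "(i, j) \<in> act \<kappa> w"
    using w by auto
  then consider "(S0, j) \<in> act \<kappa> w" | "(S1, j) \<in> act \<kappa> w" | "(S2, j) \<in> act \<kappa> w"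
    by (cases i) auto
  then show ?thesis
  proof cases
    case 1
    then show ?thesis using S0 by blast
  next
    case 2
    then show ?thesis using S1[of j w] by (metis replicate_0)
  next
    case 3
    then show ?thesis using S2 by blast
  qed
qed

lemma remdups_adj_one_letter:
  assumes "set u \<subseteq> {a}" "set v = set u"
  shows "remdups_adj u = remdups_adj v"
proof -
  have "w = replicate (length w) a" if "set w \<subseteq> {a}" for w
    using that by (induction w) auto
  then have "remdups_adj w = (if w = [] then [] else [a])" if "set w \<subseteq> {a}" for w
    using that remdups_adj_replicate[of "length w" a] by (metis length_0_conv)
  then show ?thesis
    using assms by (metis set_empty)
qed

text \<open>Without the subsequence \<open>ba\<close> such a word is a power of a followed by a
  power of b, so the content determines its collapsed form.\<close>

lemma remdups_adj_two_letters:
  assumes "a \<noteq> b" "set u \<subseteq> {a, b}" "\<not> sub2 b a u" "\<not> sub2 b a v" "set v = set u"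
  shows "remdups_adj u = remdups_adj v"
proof -
  have sorted: "remdups_adj w = (if a \<in> set w then [a] else []) @ (if b \<in> set w then [b] else [])"
    if "set w \<subseteq> {a, b}" "\<not> sub2 b a w" for w
    using that
  proof (induction w rule: remdups_adj.induct)
    case (3 x y w)
    then show ?case using assms(1) by auto
  qed (use assms(1) in auto)
  show ?thesis
    using assms sorted[of u] sorted[of v] by simp
qed

lemma act_A_other: "g \<notin> {Gen_f, Gen_e, Gen_c} \<Longrightarrow> act_A g = {}"
  by (cases g) simp_all

lemma act_Q_other: "g \<notin> {Gen_e, Gen_b, Gen_c} \<Longrightarrow> act_Q g = {}"
  by (cases g) simp_all

text \<open>The letters \<open>a, b, t\<close> play the roles of \<open>f, e, c\<close> in \<open>A\<close>, and \<open>a, t, s\<close> those of \<open>e, b, c\<close> in \<open>Q\<close>.\<close>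

definition letters_A :: "'a \<Rightarrow> 'a \<Rightarrow> 'a \<Rightarrow> 'a \<Rightarrow> state rel" where
  "letters_A a b t x = (if x = a then {(S0, S0), (S2, S2)} else if x = b then {(S0, S1), (S1, S1)}
     else if x = t then {(S0, S2), (S1, S2)} else {})"

definition letters_Q :: "'a \<Rightarrow> 'a \<Rightarrow> 'a \<Rightarrow> 'a \<Rightarrow> state rel" where
  "letters_Q a t s x = (if x = a then {(S0, S0), (S2, S2)} else if x = t then {(S0, S1)}
     else if x = s then {(S1, S2)} else {})"

lemma letters_A_idem: "x \<noteq> t \<Longrightarrow> letters_A a b t x O letters_A a b t x = letters_A a b t x"
  by (simp add: letters_A_def generator_relcomp)

lemma letters_Q_idem:
  "x \<noteq> t \<Longrightarrow> x \<noteq> s \<Longrightarrow> letters_Q a t s x O letters_Q a t s x = letters_Q a t s x"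
  by (simp add: letters_Q_def generator_relcomp)

lemma letters_A_values:
  assumes "distinct [a, b, t]"
  shows "letters_A a b t a = {(S0, S0), (S2, S2)}" "letters_A a b t b = {(S0, S1), (S1, S1)}"
    "letters_A a b t t = {(S0, S2), (S1, S2)}" "\<And>x. x \<notin> {a, b, t} \<Longrightarrow> letters_A a b t x = {}"
  using assms by (auto simp: letters_A_def)

lemma letters_Q_values:
  assumes "distinct [a, t, s]"
  shows "letters_Q a t s a = {(S0, S0), (S2, S2)}" "letters_Q a t s t = {(S0, S1)}"
    "letters_Q a t s s = {(S1, S2)}" "\<And>x. x \<notin> {a, t, s} \<Longrightarrow> letters_Q a t s x = {}"
  using assms by (auto simp: letters_Q_def)

lemma relcomp_S0_S2: "{(S0, S0), (S2, S2)} O {(S0, S2)} = {(S0, S2)}"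
  by auto

lemma act_letters_A:
  assumes "distinct [a, b, t]"
  shows "act (letters_A a b t) [a, a] = {(S0, S0), (S2, S2)}"
    "act (letters_A a b t) [b, b] = {(S0, S1), (S1, S1)}"
    "act (letters_A a b t) [b, b, t, a, a] = {(S0, S2), (S1, S2)}"
    "act (letters_A a b t) [a, a, b, b] = {(S0, S1)}"
    "act (letters_A a b t) [a, a, b, b, t, a, a] = {(S0, S2)}"
  by (simp_all add: letters_A_values[OF assms] generator_relcomp relcomp_S0_S2)

lemma act_letters_Q:
  assumes "distinct [a, t, s]"
  shows "act (letters_Q a t s) [a, a] = {(S0, S0), (S2, S2)}"
    "act (letters_Q a t s) [a, a, t] = {(S0, S1)}"
    "act (letters_Q a t s) [s, a, a] = {(S1, S2)}"
    "act (letters_Q a t s) [a, a, t, s, a, a] = {(S0, S2)}"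
  by (simp_all add: letters_Q_values[OF assms] generator_relcomp relcomp_S0_S2)

lemma gamma_A0:
  assumes "a \<noteq> b" "set w \<subseteq> {a, b}" "\<not> sub2 b a w" "agree2 w w'"
  shows "(w, w') \<in> gamma"
  unfolding gamma_iff
proof (intro conjI allI)
  have two: "sub2 y z w \<longleftrightarrow> sub2 y z w'" for y z
    using assms(4) by (simp add: agree2_def)
  then show "sub2 x x w \<longleftrightarrow> sub2 x x w'" for x .
  have "\<not> sub2 b a w'" "set w' = set w"
    using assms(3,4) two by (simp_all add: agree2_def)
  with assms(1-3) show "remdups_adj w = remdups_adj w'"
    by (rule remdups_adj_two_letters)
qed

lemma gamma_A:
  assumes abt: "distinct [a, b, t]" and p: "set p \<subseteq> {a, b}" "\<not> sub2 b a p"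
    and p': "\<not> sub2 b a p'" "set p' = set p" and q: "set q \<subseteq> {a}" "set q' = set q"
    and mult: "\<And>x. sub2 x x (p @ t # q) \<longleftrightarrow> sub2 x x (p' @ t # q')"
  shows "(p @ t # q, p' @ t # q') \<in> gamma"
  unfolding gamma_iff
proof (intro conjI allI mult)
  have "a \<noteq> b"
    using abt by simp
  then have "remdups_adj p = remdups_adj p'"
    using p p' by (rule remdups_adj_two_letters)
  moreover have "remdups_adj q = remdups_adj q'"
    using q by (rule remdups_adj_one_letter)
  moreover have "t \<notin> set p" "t \<notin> set q"
    using abt p q by auto
  ultimately show "remdups_adj (p @ t # q) = remdups_adj (p' @ t # q')"
    using remdups_adj_split[of t p q] remdups_adj_split[of t p' q'] p' q by simp
qed

lemma gamma_Q:
  assumes ats: "distinct [a, t, s]" and p: "set p \<subseteq> {a}" "set p' = set p"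
    and q: "set q \<subseteq> {a}" "set q' = set q"
    and mult: "\<And>x. sub2 x x (p @ t # s # q) \<longleftrightarrow> sub2 x x (p' @ t # s # q')"
  shows "(p @ t # s # q, p' @ t # s # q') \<in> gamma"
  unfolding gamma_iff
proof (intro conjI allI mult)
  have "remdups_adj p = remdups_adj p'"
    using p by (rule remdups_adj_one_letter)
  moreover have "remdups_adj q = remdups_adj q'"
    using q by (rule remdups_adj_one_letter)
  moreover have "t \<notin> set p" "t \<notin> set q" "s \<notin> set q" "t \<noteq> s"
    using ats p q by auto
  ultimately show "remdups_adj (p @ t # s # q) = remdups_adj (p' @ t # s # q')"
    using remdups_adj_split[of t p "s # q"] remdups_adj_split[of t p' "s # q'"]
      remdups_adj_split[of s "[]" q] remdups_adj_split[of s "[]" q'] p q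
    by simp
qed

text \<open>Pairs fix the contents on both sides of the simple letter t; the order of a and b before
  t comes from the absence of the triple \<open>bat\<close>.\<close>

lemma isoterm_A:
  assumes abt: "distinct [a, b, t]" and w: "w = replicate i a @ replicate j b @ t # replicate k a"
    and ids: "(w, w') \<in> ids act_A {Gen_e, Gen_f, Gen_c}"
  shows "(w, w') \<in> gamma"
proof -
  have agree: "agree2 w w'"
    using ids ids_A_subset_A0 ids_A0_imp_agree2 by blast
  then have set: "set w = set w'" and two: "\<And>y z. sub2 y z w \<longleftrightarrow> sub2 y z w'"
    by (simp_all add: agree2_def)
  define p q where "p = replicate i a @ replicate j b" and "q = replicate k a"
  have w_eq: "w = p @ t # q"
    by (simp add: w p_def q_def)
  have p: "set p \<subseteq> {a, b}" "\<not> sub2 b a p" and q: "set q \<subseteq> {a}"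
    using abt by (auto simp: p_def q_def)
  have t: "t \<notin> set p" "t \<notin> set q"
    using p q abt by auto
  then have tt: "\<not> sub2 t t w" and tb: "\<not> sub2 t b w"
    using p q abt by (auto simp: w_eq dest: sub2_set)
  have "t \<in> set w'" "\<not> sub2 t t w'"
    using set two tt by (auto simp: w_eq)
  then obtain p' q' where w': "w' = p' @ t # q'" and t': "t \<notin> set p'" "t \<notin> set q'"
    by (rule simple_split)
  have "y \<in> set p \<longleftrightarrow> y \<in> set p'" "y \<in> set q \<longleftrightarrow> y \<in> set q'" for y
    using two[of y t] two[of t y] t t' by (auto simp: w_eq w' dest: sub2_set)
  then have sets: "set p' = set p" "set q' = set q"
    by blast+
  \<comment> \<open>The side condition of \<open>ids_A_sub3\<close> holds: b does not occur after
    t.\<close>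
  have "\<not> sub3 b a t w"
    using p(2) t by (auto simp: w_eq dest: sub2_set sub3_imp2)
  then have "\<not> sub3 b a t w'"
    using ids_A_sub3[OF ids, of t b a] tt tb abt by auto
  then have "\<not> sub2 b a p'"
    by (simp add: w')
  then show ?thesis
    using gamma_A[OF abt p _ sets(1) q sets(2)] two unfolding w_eq w' by blast
qed

text \<open>The simple letters cut the word into blocks over the single letter a, which are
  determined up to collapsing by their contents. The hypothesis is \<open>agree_Q\<close>, so the
  lemma applies to identities of Q, of A and of its dual.\<close>

lemma isoterm_Q:
  assumes ats: "distinct [a, t, s]" and agree: "agree_Q w w'"
    and w: "w = replicate i a \<or> w = replicate i a @ [t] \<or> w = s # replicate k a \<or>
      w = replicate i a @ t # s # replicate k a"
  shows "(w, w') \<in> gamma"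
proof -
  have set: "set w = set w'" and mult: "\<And>x. sub2 x x w \<longleftrightarrow> sub2 x x w'"
    and right: "\<And>x y. \<not> sub2 x x w \<Longrightarrow> sub2 x y w \<longleftrightarrow> sub2 x y w'"
    and left: "\<And>x y. \<not> sub2 x x w \<Longrightarrow> sub2 y x w \<longleftrightarrow> sub2 y x w'"
    and three: "\<And>x y z. \<not> sub2 x x w \<Longrightarrow> \<not> sub2 z z w \<Longrightarrow> sub3 x y z w \<longleftrightarrow> sub3 x y z w'"
    using agree unfolding agree_Q_def by blast+
  have split: "\<exists>p q. w' = p @ x # q \<and> x \<notin> set p \<and> x \<notin> set q" if "x \<in> set w" "\<not> sub2 x x w" for x
    using that set mult simple_split[of x w'] by metis
  have "remdups_adj w = remdups_adj w'"
    using w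
  proof (elim disjE)
    assume w: "w = replicate i a"
    show ?thesis
      using set by (intro remdups_adj_one_letter[of w a]) (auto simp: w)
  next
    assume w: "w = replicate i a @ [t]"
    have t: "t \<in> set w" "\<not> sub2 t t w"
      using ats by (auto simp: w)
    then obtain p q where w': "w' = p @ t # q" and tp: "t \<notin> set p" "t \<notin> set q"
      using split by blast
    have "y \<notin> set q" for y
      using right[OF t(2), of y] ats by (auto simp: w w' dest: sub2_set)
    then have q: "q = []"
      by (cases q) auto
    have "y \<in> set p \<longleftrightarrow> y \<in> set (replicate i a)" for y
      using left[OF t(2), of y] ats tp by (auto simp: w w' q dest: sub2_set)
    then have "set p = set (replicate i a)"
      by blast
    then have "remdups_adj (replicate i a) = remdups_adj p"
      by (intro remdups_adj_one_letter[of _ a]) auto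
    then show ?thesis
      using remdups_adj_split[of t p "[]"] remdups_adj_split[of t "replicate i a" "[]"] tp ats
      by (simp add: w w' q)
  next
    assume w: "w = s # replicate k a"
    have s: "s \<in> set w" "\<not> sub2 s s w"
      using ats by (auto simp: w)
    then obtain p q where w': "w' = p @ s # q" and sp: "s \<notin> set p" "s \<notin> set q"
      using split by blast
    have "y \<notin> set p" for y
      using left[OF s(2), of y] ats sp by (auto simp: w w' dest: sub2_set)
    then have p: "p = []"
      by (cases p) auto
    have "y \<in> set q \<longleftrightarrow> y \<in> set (replicate k a)" for y
      using right[OF s(2), of y] ats sp by (auto simp: w w' p dest: sub2_set)
    then have "set q = set (replicate k a)"
      by blast
    then have "remdups_adj (replicate k a) = remdups_adj q"
      by (intro remdups_adj_one_letter[of _ a]) auto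
    then show ?thesis
      using remdups_adj_split[of s "[]" q] remdups_adj_split[of s "[]" "replicate k a"] sp ats
      by (simp add: w w' p)
  next
    assume "w = replicate i a @ t # s # replicate k a"
    then obtain p q where w: "w = p @ t # s # q" and p: "set p \<subseteq> {a}" and q: "set q \<subseteq> {a}"
      by (metis set_replicate_conv_if empty_subsetI subset_refl)
    have sets: "t \<notin> set p" "t \<notin> set q" "s \<notin> set p" "s \<notin> set q" "t \<noteq> s"
      using p q ats by auto
    have t: "t \<in> set w" "\<not> sub2 t t w" and s: "s \<in> set w" "\<not> sub2 s s w"
      using sets by (auto simp: w dest: sub2_set)
    obtain p' r where w'_t: "w' = p' @ t # r" and t': "t \<notin> set p'" "t \<notin> set r"
      using split[OF t] by blast
    have "sub2 t s w'"
      using right[OF t(2), of s] by (simp add: w)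
    then have "s \<in> set r"
      using t' by (auto simp: w'_t dest: sub2_set)
    moreover have "\<not> sub2 s s w'"
      using s mult by simp
    then have "\<not> sub2 s s r"
      by (auto simp: w'_t)
    ultimately obtain m q' where r: "r = m @ s # q'" and s': "s \<notin> set m" "s \<notin> set q'"
      by (rule simple_split)
    have sp': "s \<notin> set p'"
      using \<open>\<not> sub2 s s w'\<close> by (auto simp: w'_t r)
    \<comment> \<open>A letter between t and s would give a triple \<open>tys\<close>, and w has
      none.\<close>
    have "y \<notin> set m" for y
    proof
      assume "y \<in> set m"
      then have "sub3 t y s w'"
        by (simp add: w'_t r)
      then have "sub3 t y s w"
        using three t s by blast
      then show False
        using sets by (auto simp: w dest: sub2_set sub3_imp2)
    qed
    then have m: "m = []"
      by (cases m) auto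
    have w': "w' = p' @ t # s # q'"
      by (simp add: w'_t r m)
    have "y \<in> set p' \<longleftrightarrow> y \<in> set p" "y \<in> set q' \<longleftrightarrow> y \<in> set q" for y
      using left[OF t(2), of y] right[OF s(2), of y] sets t' s' sp'
      by (auto simp: w w' r dest: sub2_set)
    then have "set p' = set p" "set q' = set q"
      by blast+
    then have "(w, w') \<in> gamma"
      using gamma_Q[OF ats p _ q] mult unfolding w w' by blast
    then show ?thesis
      by (simp add: gamma_iff)
  qed
  then show ?thesis
    using mult by (simp add: gamma_iff)
qed

text \<open>The automaton of A is reused; the content of the defining word then excludes t.\<close>

lemma factor_A0:
  assumes "distinct [a, b, t]" "factor {[a, a, b, b]} w"
  shows "set w \<subseteq> {a, b} \<and> \<not> sub2 b a w"
proof -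
  have "act (letters_A a b t) w \<noteq> {}"
  proof (rule act_factor[OF assms(2)])
    fix x assume "sub2 x x [a, a, b, b]"
    then show "letters_A a b t x O letters_A a b t x = letters_A a b t x"
      using assms(1) by (intro letters_A_idem) auto
  qed (simp only: act_letters_A[OF assms(1)], simp)
  then obtain i j k
    where "w = replicate i a @ replicate j b \<or> w = replicate i a @ replicate j b @ t # replicate k a"
    using shape_A[OF letters_A_values[OF assms(1)], of w] by blast
  moreover have "set w \<subseteq> {a, b}"
    using factor_set[OF assms(2)] by auto
  ultimately show ?thesis
    using assms(1) by auto
qed

lemma factor_A:
  assumes "distinct [a, b, t]" "factor {[a, a, b, b, t, a, a]} w"
  shows "\<exists>i j k. w = replicate i a @ replicate j b \<or> w = replicate i a @ replicate j b @ t # replicate k a"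
proof -
  have "act (letters_A a b t) w \<noteq> {}"
  proof (rule act_factor[OF assms(2)])
    fix x assume "sub2 x x [a, a, b, b, t, a, a]"
    then show "letters_A a b t x O letters_A a b t x = letters_A a b t x"
      using assms(1) by (intro letters_A_idem) auto
  qed (simp only: act_letters_A[OF assms(1)], simp)
  then show ?thesis
    using shape_A[OF letters_A_values[OF assms(1)], of w] by blast
qed

lemma factor_Q:
  assumes "distinct [a, t, s]" "factor {[a, a, t, s, a, a]} w"
  shows "\<exists>i k. w = replicate i a \<or> w = replicate i a @ [t] \<or> w = s # replicate k a \<or>
    w = replicate i a @ t # s # replicate k a"
proof -
  have "act (letters_Q a t s) w \<noteq> {}"
  proof (rule act_factor[OF assms(2)])
    fix x assume "sub2 x x [a, a, t, s, a, a]"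
    then show "letters_Q a t s x O letters_Q a t s x = letters_Q a t s x"
      using assms(1) by (intro letters_Q_idem) auto
  qed (simp only: act_letters_Q[OF assms(1)], simp)
  then show ?thesis
    using shape_Q[OF letters_Q_values[OF assms(1)], of w] by blast
qed

section \<open>The identities of the monoids over \<gamma> for A_0, A and Q\<close>

lemma concat_replicate_pair: "concat (replicate n [a, a]) = replicate (2 * n) a"
  by (induction n) simp_all

lemma ids_M_A0:
  assumes abt: "distinct [a, b, t]"
  shows "ids_M {[a, a, b, b]} = ids act_A {Gen_e, Gen_f}"
proof
  show "ids act_A {Gen_e, Gen_f} \<subseteq> ids_M {[a, a, b, b]}"
  proof (rule ids_subset_ids_M[OF ids_subst ids_sym])
    fix w w' :: word
    assume "factor {[a, a, b, b]} w" "(w, w') \<in> ids act_A {Gen_e, Gen_f}"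
    then show "(w, w') \<in> gamma"
      using factor_A0[OF abt, of w] ids_A0_imp_agree2[of w w'] abt by (intro gamma_A0[of a b]) simp_all
  qed
  \<comment> \<open>Squares, because e and f are idempotent: \<open>aa\<close> is idempotent modulo
    \<gamma>, the single letter a is not.\<close>
  let ?\<psi> = "\<lambda>g. if g = Gen_f then [a, a] else [b, b]"
  show "ids_M {[a, a, b, b]} \<subseteq> ids act_A {Gen_e, Gen_f}"
  proof (rule ids_M_subset_ids[of _ "letters_A a b t" ?\<psi>])
    show "act (letters_A a b t) (?\<psi> g) = act_A g" if "g \<in> {Gen_e, Gen_f}" for g
      using that by (auto simp del: act_Cons simp: act_letters_A[OF abt])
    show "letters_A a b t x O letters_A a b t x = letters_A a b t x" if "sub2 x x [a, a, b, b]" for x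
      using that abt by (intro letters_A_idem) auto
    fix p assume p: "p \<in> lists {Gen_e, Gen_f}" "act act_A p \<noteq> {}"
    have "\<exists>i j k. p = replicate i Gen_f @ replicate j Gen_e \<or>
        p = replicate i Gen_f @ replicate j Gen_e @ Gen_c # replicate k Gen_f"
      by (rule shape_A[OF _ _ _ act_A_other p(2)]) simp_all
    moreover have "Gen_c \<notin> set p"
      using p(1) by auto
    ultimately obtain i j where "p = replicate i Gen_f @ replicate j Gen_e"
      by auto
    then have "concat (map ?\<psi> p) = replicate (2 * i) a @ replicate (2 * j) b"
      by (simp add: concat_replicate_pair)
    \<comment> \<open>Padding on both sides covers zero exponents.\<close>
    moreover have "([a, a, b, b], [a, a] @ (replicate (2 * i) a @ replicate (2 * j) b) @ [b, b]) \<in> gamma"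
      using abt by (intro gamma_A0[of a b]) (auto simp: agree2_def)
    ultimately have "([a, a, b, b], [a, a] @ concat (map ?\<psi> p) @ [b, b]) \<in> gamma"
      by (simp only:)
    then show "factor {[a, a, b, b]} (concat (map ?\<psi> p))"
      unfolding factor_def by blast
  qed
qed

lemma ids_M_A:
  assumes abt: "distinct [a, b, t]"
  shows "ids_M {[a, a, b, b, t, a, a]} = ids act_A {Gen_e, Gen_f, Gen_c}"
proof
  let ?w = "[a, a, b, b, t, a, a]"
  show "ids act_A {Gen_e, Gen_f, Gen_c} \<subseteq> ids_M {?w}"
  proof (rule ids_subset_ids_M[OF ids_subst ids_sym])
    fix w w' assume w: "factor {?w} w" "(w, w') \<in> ids act_A {Gen_e, Gen_f, Gen_c}"
    obtain i j k where "w = replicate i a @ replicate j b \<or>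
        w = replicate i a @ replicate j b @ t # replicate k a"
      using factor_A[OF abt w(1)] by blast
    then show "(w, w') \<in> gamma"
    proof
      assume "w = replicate i a @ replicate j b"
      moreover have "agree2 w w'"
        using ids_A_subset_A0 w(2) by (intro ids_A0_imp_agree2) (rule subsetD)
      ultimately show ?thesis
        using abt by (intro gamma_A0[of a b]) auto
    next
      assume "w = replicate i a @ replicate j b @ t # replicate k a"
      then show ?thesis
        using w(2) by (rule isoterm_A[OF abt])
    qed
  qed
  \<comment> \<open>The word for c carries \<open>bb\<close> on the left and \<open>aa\<close> on
    the right to absorb e and f, as ec = c and cf = c demand.\<close>
  let ?\<psi> = "\<lambda>g. if g = Gen_f then [a, a] else if g = Gen_e then [b, b] else [b, b, t, a, a]"
  show "ids_M {?w} \<subseteq> ids act_A {Gen_e, Gen_f, Gen_c}"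
  proof (rule ids_M_subset_ids[of _ "letters_A a b t" ?\<psi>])
    show "act (letters_A a b t) (?\<psi> g) = act_A g" if "g \<in> {Gen_e, Gen_f, Gen_c}" for g
      using that by (auto simp del: act_Cons simp: act_letters_A[OF abt])
    show "letters_A a b t x O letters_A a b t x = letters_A a b t x" if "sub2 x x ?w" for x
      using that abt by (intro letters_A_idem) auto
    fix p assume p: "p \<in> lists {Gen_e, Gen_f, Gen_c}" "act act_A p \<noteq> {}"
    have "\<exists>i j k. p = replicate i Gen_f @ replicate j Gen_e \<or>
        p = replicate i Gen_f @ replicate j Gen_e @ Gen_c # replicate k Gen_f"
      by (rule shape_A[OF _ _ _ act_A_other p(2)]) simp_all
    then obtain i j k where ijk: "p = replicate i Gen_f @ replicate j Gen_e \<or>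
        p = replicate i Gen_f @ replicate j Gen_e @ Gen_c # replicate k Gen_f"
      by blast
    \<comment> \<open>The exponent l is 0 for words without c and twice the exponent k for words
      with c.\<close>
    have embed: "(([a, a] @ [b, b]) @ t # [a, a],
        ([a, a] @ replicate (2 * i) a @ replicate (2 * j) b @ [b, b]) @ t # ([a, a] @ replicate l a)) \<in> gamma" for l
    proof (rule gamma_A[OF abt])
      show "sub2 x x (([a, a] @ [b, b]) @ t # [a, a]) \<longleftrightarrow> sub2 x x
          (([a, a] @ replicate (2 * i) a @ replicate (2 * j) b @ [b, b]) @ t # ([a, a] @ replicate l a))" for x
        using abt by (cases "x = a"; cases "x = b") simp_all
    qed (use abt in auto)
    from ijk show "factor {?w} (concat (map ?\<psi> p))"
    proof
      assume "p = replicate i Gen_f @ replicate j Gen_e"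
      then have "concat (map ?\<psi> p) = replicate (2 * i) a @ replicate (2 * j) b"
        by (simp add: concat_replicate_pair)
      then have "(?w, [a, a] @ concat (map ?\<psi> p) @ [b, b, t, a, a]) \<in> gamma"
        using embed[of 0] by simp
      then show ?thesis
        unfolding factor_def by blast
    next
      assume "p = replicate i Gen_f @ replicate j Gen_e @ Gen_c # replicate k Gen_f"
      then have "concat (map ?\<psi> p) = replicate (2 * i) a @ replicate (2 * j) b @ [b, b, t, a, a] @ replicate (2 * k) a"
        by (simp add: concat_replicate_pair)
      then have "(?w, [a, a] @ concat (map ?\<psi> p) @ []) \<in> gamma"
        using embed[of "2 * k"] by simp
      then show ?thesis
        unfolding factor_def by blast
    qed
  qed
qed

lemma ids_M_Q_supset:
  assumes ats: "distinct [a, t, s]"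
    and "\<And>u v \<theta>. (u, v) \<in> E \<Longrightarrow> (subst \<theta> u, subst \<theta> v) \<in> E"
    and "\<And>u v. (u, v) \<in> E \<Longrightarrow> (v, u) \<in> E" and agree: "\<And>u v. (u, v) \<in> E \<Longrightarrow> agree_Q u v"
  shows "E \<subseteq> ids_M {[a, a, t, s, a, a]}"
proof (rule ids_subset_ids_M[OF assms(2,3)])
  fix w w' assume w: "factor {[a, a, t, s, a, a]} w" "(w, w') \<in> E"
  obtain i k where "w = replicate i a \<or> w = replicate i a @ [t] \<or> w = s # replicate k a \<or>
      w = replicate i a @ t # s # replicate k a"
    using factor_Q[OF ats w(1)] by blast
  then show "(w, w') \<in> gamma"
    by (rule isoterm_Q[OF ats agree[OF w(2)]])
qed

lemma ids_M_Q:
  assumes ats: "distinct [a, t, s]"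
  shows "ids_M {[a, a, t, s, a, a]} = ids act_Q {Gen_e, Gen_b, Gen_c}"
proof
  let ?w = "[a, a, t, s, a, a]"
  show "ids act_Q {Gen_e, Gen_b, Gen_c} \<subseteq> ids_M {?w}"
    by (rule ids_M_Q_supset[OF ats ids_subst ids_sym ids_Q_imp_agree_Q])
  \<comment> \<open>The \<open>aa\<close> in the words for b and c absorbs e, as eb = b and ce = c
    demand.\<close>
  let ?\<psi> = "\<lambda>g. if g = Gen_e then [a, a] else if g = Gen_b then [a, a, t] else [s, a, a]"
  show "ids_M {?w} \<subseteq> ids act_Q {Gen_e, Gen_b, Gen_c}"
  proof (rule ids_M_subset_ids[of _ "letters_Q a t s" ?\<psi>])
    show "act (letters_Q a t s) (?\<psi> g) = act_Q g" if "g \<in> {Gen_e, Gen_b, Gen_c}" for g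
      using that by (auto simp del: act_Cons simp: act_letters_Q[OF ats])
    show "letters_Q a t s x O letters_Q a t s x = letters_Q a t s x" if "sub2 x x ?w" for x
      using that ats by (intro letters_Q_idem) auto
    fix p assume p: "p \<in> lists {Gen_e, Gen_b, Gen_c}" "act act_Q p \<noteq> {}"
    have "\<exists>i k. p = replicate i Gen_e \<or> p = replicate i Gen_e @ [Gen_b] \<or>
        p = Gen_c # replicate k Gen_e \<or> p = replicate i Gen_e @ Gen_b # Gen_c # replicate k Gen_e"
      by (rule shape_Q[OF _ _ _ act_Q_other p(2)]) simp_all
    then obtain i k where ik: "p = replicate i Gen_e \<or> p = replicate i Gen_e @ [Gen_b] \<or>
        p = Gen_c # replicate k Gen_e \<or> p = replicate i Gen_e @ Gen_b # Gen_c # replicate k Gen_e"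
      by blast
    have embed: "([a, a] @ t # s # [a, a], (replicate i a @ [a, a]) @ t # s # ([a, a] @ replicate k a)) \<in> gamma" for i k
    proof (rule gamma_Q[OF ats])
      show "sub2 x x ([a, a] @ t # s # [a, a]) \<longleftrightarrow>
          sub2 x x ((replicate i a @ [a, a]) @ t # s # ([a, a] @ replicate k a))" for x
        using ats by (cases "x = a") auto
    qed (use ats in auto)
    have factorI: "factor {?w} v" if "(?w, r @ v @ r') \<in> gamma" for r v r'
      using that unfolding factor_def by blast
    from ik show "factor {?w} (concat (map ?\<psi> p))"
    proof (elim disjE)
      assume "p = replicate i Gen_e"
      then show ?thesis
        using embed[of "2 * i" 0] by (intro factorI[of "[]" _ "[a, a, t, s, a, a]"]) (simp add: concat_replicate_pair)
    next
      assume "p = replicate i Gen_e @ [Gen_b]"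
      then show ?thesis
        using embed[of "2 * i" 0] by (intro factorI[of "[]" _ "[s, a, a]"]) (simp add: concat_replicate_pair)
    next
      assume "p = Gen_c # replicate k Gen_e"
      then show ?thesis
        using embed[of 0 "2 * k"] by (intro factorI[of "[a, a, t]" _ "[]"]) (simp add: concat_replicate_pair)
    next
      assume "p = replicate i Gen_e @ Gen_b # Gen_c # replicate k Gen_e"
      then show ?thesis
        using embed[of "2 * i" "2 * k"] by (intro factorI[of "[]" _ "[]"]) (simp add: concat_replicate_pair)
    qed
  qed
qed

text \<open>Since \<open>agree2\<close> is invariant under reversal, the reversed identities of A
  still determine the factors of \<open>aabb\<close> up to \<gamma>; the concrete letters are
  arbitrary.\<close>

lemma dual_A_subset_A0: "rev_ids (ids act_A {Gen_e, Gen_f, Gen_c}) \<subseteq> ids act_A {Gen_e, Gen_f}"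
proof -
  have abt: "distinct [0, 1, 2 :: letter]" by simp
  have "rev_ids (ids act_A {Gen_e, Gen_f, Gen_c}) \<subseteq> ids_M {[0, 0, 1, 1]}"
  proof (rule ids_subset_ids_M[OF rev_ids_subst])
    show "(v, u) \<in> rev_ids (ids act_A {Gen_e, Gen_f, Gen_c})"
      if "(u, v) \<in> rev_ids (ids act_A {Gen_e, Gen_f, Gen_c})" for u v
      using that ids_sym by simp
    fix w w' :: word
    assume w: "factor {[0, 0, 1, 1]} w" "(w, w') \<in> rev_ids (ids act_A {Gen_e, Gen_f, Gen_c})"
    then have "(rev w, rev w') \<in> ids act_A {Gen_e, Gen_f}"
      using ids_A_subset_A0 by auto
    then have "agree2 w w'"
      using ids_A0_imp_agree2 agree2_rev by blast
    then show "(w, w') \<in> gamma"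
      using factor_A0[OF abt w(1)] by (intro gamma_A0[of 0 1]) simp_all
  qed
  then show ?thesis
    using ids_M_A0[OF abt] by simp
qed

lemma A_subset_Q: "ids act_A {Gen_e, Gen_f, Gen_c} \<subseteq> ids act_Q {Gen_e, Gen_b, Gen_c}"
  and dual_A_subset_Q: "rev_ids (ids act_A {Gen_e, Gen_f, Gen_c}) \<subseteq> ids act_Q {Gen_e, Gen_b, Gen_c}"
proof -
  have ats: "distinct [0, 1, 2 :: letter]" by simp
  show "ids act_A {Gen_e, Gen_f, Gen_c} \<subseteq> ids act_Q {Gen_e, Gen_b, Gen_c}"
    unfolding ids_M_Q[OF ats, symmetric]
    by (rule ids_M_Q_supset[OF ats ids_subst ids_sym ids_A_imp_agree_Q])
  show "rev_ids (ids act_A {Gen_e, Gen_f, Gen_c}) \<subseteq> ids act_Q {Gen_e, Gen_b, Gen_c}"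
    unfolding ids_M_Q[OF ats, symmetric]
  proof (rule ids_M_Q_supset[OF ats])
    show "agree_Q u v" if "(u, v) \<in> rev_ids (ids act_A {Gen_e, Gen_f, Gen_c})" for u v
      using that ids_A_imp_agree_Q[of "rev u" "rev v"] by (simp add: agree_Q_rev)
    show "(v, u) \<in> rev_ids (ids act_A {Gen_e, Gen_f, Gen_c})"
      if "(u, v) \<in> rev_ids (ids act_A {Gen_e, Gen_f, Gen_c})" for u v
      using that ids_sym by simp
  qed (rule rev_ids_subst)
qed

theorem theorem4p3:
  fixes a b t s :: letter
  assumes letters: "distinct [a, b, t, s]"
    and universe: "infinite (UNIV :: 'x set)"
  shows
    "(var_Q :: 'x monoid set) = var_M gamma {mplus a \<cdot>\<^sub>\<gamma> once t \<cdot>\<^sub>\<gamma> once s \<cdot>\<^sub>\<gamma> mplus a}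

     \<and> (variety_meet (var_A :: 'x monoid set) (dual_variety var_A) = variety_join var_A0 var_Q
        \<and> variety_join (var_A0 :: 'x monoid set) var_Q =
            var_M gamma {mplus a \<cdot>\<^sub>\<gamma> mplus b, mplus a \<cdot>\<^sub>\<gamma> once t \<cdot>\<^sub>\<gamma> once s \<cdot>\<^sub>\<gamma> mplus a})

     \<and> ((var_A :: 'x monoid set) = var_M gamma {mplus a \<cdot>\<^sub>\<gamma> mplus b \<cdot>\<^sub>\<gamma> once t \<cdot>\<^sub>\<gamma> mplus a}
        \<and> dual_variety (var_A :: 'x monoid set) =
            var_M gamma {mplus a \<cdot>\<^sub>\<gamma> once t \<cdot>\<^sub>\<gamma> mplus b \<cdot>\<^sub>\<gamma> mplus a})

     \<and> variety_join (var_A :: 'x monoid set) (dual_variety var_A) =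
          var_M gamma {mplus a \<cdot>\<^sub>\<gamma> mplus b \<cdot>\<^sub>\<gamma> once t \<cdot>\<^sub>\<gamma> mplus a,
                       mplus a \<cdot>\<^sub>\<gamma> once t \<cdot>\<^sub>\<gamma> mplus b \<cdot>\<^sub>\<gamma> mplus a}"
proof -
  let ?A = "ids act_A {Gen_e, Gen_f, Gen_c}"
  let ?B = "ids act_A {Gen_e, Gen_f}"
  let ?Q = "ids act_Q {Gen_e, Gen_b, Gen_c}"
  let ?V = "\<lambda>W. var_M gamma ((\<lambda>w. gamma `` {w}) ` W) :: 'x monoid set"
  have distinct: "distinct [a, b, t]" "distinct [a, t, s]"
    using letters by auto
  have join: "variety_join (models E) (models F) = (models (E \<inter> F) :: 'x monoid set)"
    if "\<exists>H :: 'x monoid. monoid H \<and> (\<forall>p. satisfies H p \<longleftrightarrow> p \<in> E)"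
      and "\<exists>H :: 'x monoid. monoid H \<and> (\<forall>p. satisfies H p \<longleftrightarrow> p \<in> F)" for E F
    using that variety_join_models[of _ E _ F] by metis
  have realized: "\<exists>H :: 'x monoid. monoid H \<and> (\<forall>p. satisfies H p \<longleftrightarrow> p \<in> ids \<tau> X)"
    for \<tau> :: "generator \<Rightarrow> state rel" and X
    using ids_realized[OF universe, of \<tau> X] by metis
  \<comment> \<open>The opposite of the witness for A satisfies exactly the reversed
    identities.\<close>
  have realized_dual: "\<exists>H :: 'x monoid. monoid H \<and> (\<forall>p. satisfies H p \<longleftrightarrow> p \<in> rev_ids ?A)"
  proof -
    obtain H :: "'x monoid" where H: "monoid H" "\<forall>p. satisfies H p \<longleftrightarrow> p \<in> ?A"
      using realized[of act_A "{Gen_e, Gen_f, Gen_c}"] by blast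
    have "satisfies (opposite H) p \<longleftrightarrow> p \<in> rev_ids ?A" for p
      using H satisfies_opposite[OF H(1), of "fst p" "snd p"] by (cases p) simp
    then show ?thesis
      using monoid_opposite[OF H(1)] by blast
  qed
  have dual_A: "dual_variety var_A = (models (rev_ids ?A) :: 'x monoid set)"
    by (simp add: var_A_eq dual_variety_models)
  have join_A0_Q: "variety_join var_A0 var_Q = (models (?B \<inter> ?Q) :: 'x monoid set)"
    unfolding var_A0_eq var_Q_eq by (intro join realized)
  have join_A_dual_A: "variety_join var_A (dual_variety var_A) = (models (?A \<inter> rev_ids ?A) :: 'x monoid set)"
    unfolding dual_variety_models var_A_eq by (intro join realized realized_dual)
  have meet: "variety_meet var_A (dual_variety var_A) = (models (?B \<inter> ?Q) :: 'x monoid set)"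
  proof
    show "variety_meet var_A (dual_variety var_A) \<subseteq> (models (?B \<inter> ?Q) :: 'x monoid set)"
      unfolding dual_variety_models var_A_eq by (rule meet_A_dual_A)
    show "(models (?B \<inter> ?Q) :: 'x monoid set) \<subseteq> variety_meet var_A (dual_variety var_A)"
      unfolding var_A_eq dual_variety_models variety_meet_def
      by (intro Int_greatest models_antimono Int_greatest
          ids_A_subset_A0 A_subset_Q dual_A_subset_A0 dual_A_subset_Q)
  qed
  have ids_M_dual_A: "ids_M {[a, a, t, b, b, a, a]} = rev_ids ?A"
    using ids_M_rev[of "{[a, a, b, b, t, a, a]}"] ids_M_A[OF distinct(1)] by simp
  have M_A0_Q: "?V {[a, a, b, b], [a, a, t, s, a, a]} = models (?B \<inter> ?Q)"
    by (subst var_M_eq) (simp_all add: ids_M_pair ids_M_A0[OF distinct(1)] ids_M_Q[OF distinct(2)])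
  have M_Q: "?V {[a, a, t, s, a, a]} = models ?Q"
    by (subst var_M_eq) (simp_all add: ids_M_Q[OF distinct(2)])
  have M_A: "?V {[a, a, b, b, t, a, a]} = models ?A"
    by (subst var_M_eq) (simp_all add: ids_M_A[OF distinct(1)])
  have M_dual_A: "?V {[a, a, t, b, b, a, a]} = models (rev_ids ?A)"
    by (subst var_M_eq) (simp_all add: ids_M_dual_A)
  have M_A_dual_A: "?V {[a, a, b, b, t, a, a], [a, a, t, b, b, a, a]} = models (?A \<inter> rev_ids ?A)"
    by (subst var_M_eq) (simp_all add: ids_M_pair ids_M_A[OF distinct(1)] ids_M_dual_A)
  have classes: "mplus a \<cdot>\<^sub>\<gamma> mplus b = gamma `` {[a, a, b, b]}"
    "mplus a \<cdot>\<^sub>\<gamma> once t \<cdot>\<^sub>\<gamma> once s \<cdot>\<^sub>\<gamma> mplus a = gamma `` {[a, a, t, s, a, a]}"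
    "mplus a \<cdot>\<^sub>\<gamma> mplus b \<cdot>\<^sub>\<gamma> once t \<cdot>\<^sub>\<gamma> mplus a = gamma `` {[a, a, b, b, t, a, a]}"
    "mplus a \<cdot>\<^sub>\<gamma> once t \<cdot>\<^sub>\<gamma> mplus b \<cdot>\<^sub>\<gamma> mplus a = gamma `` {[a, a, t, b, b, a, a]}"
    by (simp_all add: gamma_mult_def mplus_eq once_eq gamma_class_mult)
  show ?thesis
    \<comment> \<open>The product of the symbols for a and b is a subterm of the first word for A,
      as products associate to the left; it must be unfolded after the longer ones.\<close>
    unfolding classes(2-4) unfolding classes(1) meet join_A0_Q join_A_dual_A unfolding dual_A unfolding var_Q_eq var_A_eq
    using M_A0_Q M_Q M_A M_dual_A M_A_dual_A by simp
qed

end
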